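(* Let $T>0$. Assume that $H:\mathbb{R}\to\mathbb{R}$ is continuous and coercive, i.e. $\lim_{|p|\to+\infty}H(p)=+\infty$, and that $F:\mathbb{R}\to\mathbb{R}$ is continuous, non-increasing and semi-coercive, i.e. $\lim_{p\to-\infty}F(p)=+\infty$. Then there exists a unique set limiter $A_F$ (namely the set $A_F$ defined in the context) such that any relaxed solution of $$u_t+H(u_x)=0 \ \text{ for } t\in(0,T),\ x>0,\qquad u_t+F(u_x)=0\ \text{ for } t\in(0,T),\ x=0,$$ is a flux-limited solution of the same problem with $F$ replaced by $F_{A_F}$.
   Context: Numbers $p^\pm$. For $H$ continuous and coercive and $p\in\mathbb{R}$, put $p^-=\sup\{q<p : H(q)\ge H(p)\}$ (a real number, by coercivity) and $p^+=\inf\{q>p : H(q)\le H(p)\}$, with $\inf\emptyset=+\infty$; if $p^+=+\infty$, the interval $[p^-,p^+]$ is read as $[p^-,+\infty)$. Set limiter. A set $A=(p_\alpha)_{\alpha\in I}$ of points of $\mathbb{R}$ is a set limiter if: (1) $p_\alpha^-\ne p_\alpha^+$ for all $\alpha\in I$; (2) for $\alpha_1,\alpha_2\in I$, if $p_{\alpha_1}<p_{\alpha_2}$ then $H(p_{\alpha_1})\ge H(p_{\alpha_2})$; (3) for every $p\in\mathbb{R}$ with $p^-<p$ there is $\alpha\in I$ with $(p^-,p)\cap(p_\alpha^-,p_\alpha^+)\neq\emptyset$, and for every $p\in\mathbb{R}$ with $p<p^+$ there is $\alpha\in I$ with $(p,p^+)\cap(p_\alpha^-,p_\alpha^+)\ne\emptyset$.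 $A$-limited flux function. For a set limiter $A=(p_\alpha)_{\alpha\in I}$, $F_A:\mathbb{R}\to\mathbb{R}$ is $F_A(p)=H(p_\alpha)$ if $p\in[p_\alpha^-,p_\alpha^+]$ for some $\alpha\in I$, and $F_A(p)=H(p)$ elsewhere. The set $A_F$ is the set of points $p\in\mathbb{R}$ satisfying at least one of the following two conditions. (a) $p^-\neq p$; $F(p)\ge H(p)$; and for all $q\in\mathbb{R}$ with $F(q)\ge H(q)$ and $(q^-,q^+)\cap(p^-,p)\ne\emptyset$ one has $H(q)\le H(p)$. (b) $p^+\ne p$; $F(p)\le H(p)$; and for all $q\in\mathbb{R}$ with $F(q)\le H(q)$ and $(q^-,q^+)\cap(p,p^+)\neq\emptyset$ one has $H(q)\ge H(p)$. Viscosity solutions. Test functions are $C^1$ functions on $(0,T)\times[0,+\infty)$. For a (locally bounded) $u:[0,T)\times[0,+\infty)\to\mathbb{R}$, $u^*(t,x)=\limsup_{(s,y)\to(t,x)}u(s,y)$ and $u_*(t,x)=\liminf_{(s,y)\to(t,x)}u(s,y)$. A test function $\phi$ touches a function $w$ from above (resp. below) at a point if $w-\phi$ has a local maximum (resp. minimum) there. $u$ is a relaxed sub-solution (resp. relaxed super-solution) if for every test function $\phi$ touching $u^*$ from above (resp. $u_*$ from below) at $(t_0,x_0)\in(0,T)\times[0,+\infty)$: if $x_0>0$, $\phi_t+H(\phi_x)\le0$ (resp. $\ge0$) at $(t_0,x_0)$; if $x_0=0$, either $\phi_t+H(\phi_x)\le0$ or $\phi_t+F(\phi_x)\le0$ (resp.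 either $\phi_t+H(\phi_x)\ge0$ or $\phi_t+F(\phi_x)\ge0$) at $(t_0,0)$. $u$ is a flux-limited sub-solution (resp. super-solution) if the same holds with the condition at $x_0=0$ replaced by $\phi_t+F(\phi_x)\le0$ (resp. $\ge0$) at $(t_0,0)$. A relaxed (resp. flux-limited) solution is a function that is both a relaxed (resp. flux-limited) sub-solution and super-solution. *)

theory Defs
  imports "HOL-Analysis.Analysis"
begin

section \<open>The numbers $p^-$ and $p^+$, set limiters, limited flux functions\<close>

definition pminus :: "(real \<Rightarrow> real) \<Rightarrow> real \<Rightarrow> real" where
  "pminus H p = Sup {q. q < p \<and> H q \<ge> H p}"

definition pplus :: "(real \<Rightarrow> real) \<Rightarrow> real \<Rightarrow> ereal" where
  "pplus H p = Inf (ereal ` {q. q > p \<and> H q \<le> H p})"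

text \<open>The intervals $[p^-, p^+]$ and $(p^-, p^+)$ are sets of reals, so for an infinite $p^+$
  they are $[p^-, +\infty)$ and $(p^-, +\infty)$.\<close>

definition closed_ival :: "(real \<Rightarrow> real) \<Rightarrow> real \<Rightarrow> real set" where
  "closed_ival H p = {r. pminus H p \<le> r \<and> ereal r \<le> pplus H p}"

definition open_ival :: "(real \<Rightarrow> real) \<Rightarrow> real \<Rightarrow> real set" where
  "open_ival H p = {r. pminus H p < r \<and> ereal r < pplus H p}"

definition left_ival :: "(real \<Rightarrow> real) \<Rightarrow> real \<Rightarrow> real set" where
  "left_ival H p = {r. pminus H p < r \<and> r < p}"

definition right_ival :: "(real \<Rightarrow> real) \<Rightarrow> real \<Rightarrow> real set" where
  "right_ival H p = {r. p < r \<and> ereal r < pplus H p}"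

definition set_limiter :: "(real \<Rightarrow> real) \<Rightarrow> real set \<Rightarrow> bool" where
  "set_limiter H A \<longleftrightarrow>
     (\<forall>a\<in>A. ereal (pminus H a) \<noteq> pplus H a) \<and>
     (\<forall>a\<in>A. \<forall>b\<in>A. a < b \<longrightarrow> H a \<ge> H b) \<and>
     (\<forall>p. pminus H p < p \<longrightarrow> (\<exists>a\<in>A. left_ival H p \<inter> open_ival H a \<noteq> {})) \<and>
     (\<forall>p. ereal p < pplus H p \<longrightarrow> (\<exists>a\<in>A. right_ival H p \<inter> open_ival H a \<noteq> {}))"

text \<open>For a set limiter the value does not depend on the point of $A$ that is chosen, see
  \<open>limited_flux_eq\<close> below.\<close>

definition limited_flux :: "(real \<Rightarrow> real) \<Rightarrow> real set \<Rightarrow> real \<Rightarrow> real" where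
  "limited_flux H A p =
     (if \<exists>a\<in>A. p \<in> closed_ival H a then H (SOME a. a \<in> A \<and> p \<in> closed_ival H a) else H p)"

definition A_F :: "(real \<Rightarrow> real) \<Rightarrow> (real \<Rightarrow> real) \<Rightarrow> real set" where
  "A_F H F = {p.
     (pminus H p \<noteq> p \<and> F p \<ge> H p \<and>
        (\<forall>q. F q \<ge> H q \<and> open_ival H q \<inter> left_ival H p \<noteq> {} \<longrightarrow> H q \<le> H p)) \<or>
     (pplus H p \<noteq> ereal p \<and> F p \<le> H p \<and>
        (\<forall>q. F q \<le> H q \<and> open_ival H q \<inter> right_ival H p \<noteq> {} \<longrightarrow> H q \<ge> H p))}"

section \<open>Viscosity solutions\<close>

definition dom0 :: "real \<Rightarrow> (real \<times> real) set" where
  "dom0 T = {0..<T} \<times> {0..}"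

definition dom :: "real \<Rightarrow> (real \<times> real) set" where
  "dom T = {0<..<T} \<times> {0..}"

text \<open>Points are pairs $(t,x)$. Functions on \<^term>\<open>dom0 T\<close> are total functions whose values outside
  \<^term>\<open>dom0 T\<close> are never used.\<close>

definition locally_bounded :: "real \<Rightarrow> (real \<times> real \<Rightarrow> real) \<Rightarrow> bool" where
  "locally_bounded T u \<longleftrightarrow>
     (\<forall>z \<in> dom0 T. \<exists>U. open U \<and> z \<in> U \<and> bounded (u ` (U \<inter> dom0 T)))"

text \<open>Semicontinuous envelopes: as usual, the point itself is not excluded from the limit.\<close>

definition upper_env :: "real \<Rightarrow> (real \<times> real \<Rightarrow> real) \<Rightarrow> real \<times> real \<Rightarrow> ereal" where
  "upper_env T u z = Limsup (inf (nhds z) (principal (dom0 T))) (\<lambda>w. ereal (u w))"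

definition lower_env :: "real \<Rightarrow> (real \<times> real \<Rightarrow> real) \<Rightarrow> real \<times> real \<Rightarrow> ereal" where
  "lower_env T u z = Liminf (inf (nhds z) (principal (dom0 T))) (\<lambda>w. ereal (u w))"

text \<open>\<open>\<phi>\<close> is $C^1$ on \<^term>\<open>dom T\<close>, up to the boundary $x = 0$, with partial derivatives
  \<open>\<phi>t\<close> and \<open>\<phi>x\<close>.\<close>

definition test_function ::
  "real \<Rightarrow> (real \<times> real \<Rightarrow> real) \<Rightarrow> (real \<times> real \<Rightarrow> real) \<Rightarrow> (real \<times> real \<Rightarrow> real) \<Rightarrow> bool" where
  "test_function T \<phi> \<phi>t \<phi>x \<longleftrightarrow>
     (\<forall>z \<in> dom T. (\<phi> has_derivative (\<lambda>(s, y). \<phi>t z * s + \<phi>x z * y)) (at z within dom T)) \<and>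
     continuous_on (dom T) \<phi>t \<and> continuous_on (dom T) \<phi>x"

definition touches_above ::
  "real \<Rightarrow> (real \<times> real \<Rightarrow> real) \<Rightarrow> (real \<times> real \<Rightarrow> ereal) \<Rightarrow> real \<times> real \<Rightarrow> bool" where
  "touches_above T \<phi> w z \<longleftrightarrow>
     eventually (\<lambda>y. w y - ereal (\<phi> y) \<le> w z - ereal (\<phi> z)) (at z within dom T)"

definition touches_below ::
  "real \<Rightarrow> (real \<times> real \<Rightarrow> real) \<Rightarrow> (real \<times> real \<Rightarrow> ereal) \<Rightarrow> real \<times> real \<Rightarrow> bool" where
  "touches_below T \<phi> w z \<longleftrightarrow>
     eventually (\<lambda>y. w y - ereal (\<phi> y) \<ge> w z - ereal (\<phi> z)) (at z within dom T)"

definition relaxed_subsolution ::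
  "real \<Rightarrow> (real \<Rightarrow> real) \<Rightarrow> (real \<Rightarrow> real) \<Rightarrow> (real \<times> real \<Rightarrow> real) \<Rightarrow> bool" where
  "relaxed_subsolution T H F u \<longleftrightarrow>
     (\<forall>\<phi> \<phi>t \<phi>x t x. test_function T \<phi> \<phi>t \<phi>x \<and> (t, x) \<in> dom T \<and>
        touches_above T \<phi> (upper_env T u) (t, x) \<longrightarrow>
        (x > 0 \<longrightarrow> \<phi>t (t, x) + H (\<phi>x (t, x)) \<le> 0) \<and>
        (x = 0 \<longrightarrow> \<phi>t (t, 0) + H (\<phi>x (t, 0)) \<le> 0 \<or> \<phi>t (t, 0) + F (\<phi>x (t, 0)) \<le> 0))"

definition relaxed_supersolution ::
  "real \<Rightarrow> (real \<Rightarrow> real) \<Rightarrow> (real \<Rightarrow> real) \<Rightarrow> (real \<times> real \<Rightarrow> real) \<Rightarrow> bool" where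
  "relaxed_supersolution T H F u \<longleftrightarrow>
     (\<forall>\<phi> \<phi>t \<phi>x t x. test_function T \<phi> \<phi>t \<phi>x \<and> (t, x) \<in> dom T \<and>
        touches_below T \<phi> (lower_env T u) (t, x) \<longrightarrow>
        (x > 0 \<longrightarrow> \<phi>t (t, x) + H (\<phi>x (t, x)) \<ge> 0) \<and>
        (x = 0 \<longrightarrow> \<phi>t (t, 0) + H (\<phi>x (t, 0)) \<ge> 0 \<or> \<phi>t (t, 0) + F (\<phi>x (t, 0)) \<ge> 0))"

definition relaxed_solution ::
  "real \<Rightarrow> (real \<Rightarrow> real) \<Rightarrow> (real \<Rightarrow> real) \<Rightarrow> (real \<times> real \<Rightarrow> real) \<Rightarrow> bool" where
  "relaxed_solution T H F u \<longleftrightarrow> relaxed_subsolution T H F u \<and> relaxed_supersolution T H F u"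

definition flux_limited_subsolution ::
  "real \<Rightarrow> (real \<Rightarrow> real) \<Rightarrow> (real \<Rightarrow> real) \<Rightarrow> (real \<times> real \<Rightarrow> real) \<Rightarrow> bool" where
  "flux_limited_subsolution T H F u \<longleftrightarrow>
     (\<forall>\<phi> \<phi>t \<phi>x t x. test_function T \<phi> \<phi>t \<phi>x \<and> (t, x) \<in> dom T \<and>
        touches_above T \<phi> (upper_env T u) (t, x) \<longrightarrow>
        (x > 0 \<longrightarrow> \<phi>t (t, x) + H (\<phi>x (t, x)) \<le> 0) \<and>
        (x = 0 \<longrightarrow> \<phi>t (t, 0) + F (\<phi>x (t, 0)) \<le> 0))"

definition flux_limited_supersolution ::
  "real \<Rightarrow> (real \<Rightarrow> real) \<Rightarrow> (real \<Rightarrow> real) \<Rightarrow> (real \<times> real \<Rightarrow> real) \<Rightarrow> bool" where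
  "flux_limited_supersolution T H F u \<longleftrightarrow>
     (\<forall>\<phi> \<phi>t \<phi>x t x. test_function T \<phi> \<phi>t \<phi>x \<and> (t, x) \<in> dom T \<and>
        touches_below T \<phi> (lower_env T u) (t, x) \<longrightarrow>
        (x > 0 \<longrightarrow> \<phi>t (t, x) + H (\<phi>x (t, x)) \<ge> 0) \<and>
        (x = 0 \<longrightarrow> \<phi>t (t, 0) + F (\<phi>x (t, 0)) \<ge> 0))"

definition flux_limited_solution ::
  "real \<Rightarrow> (real \<Rightarrow> real) \<Rightarrow> (real \<Rightarrow> real) \<Rightarrow> (real \<times> real \<Rightarrow> real) \<Rightarrow> bool" where
  "flux_limited_solution T H F u \<longleftrightarrow>
     flux_limited_subsolution T H F u \<and> flux_limited_supersolution T H F u"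

section \<open>The limited flux function is well defined\<close>

lemma set_limiter_value_unique_aux:
  assumes H: "continuous_on UNIV H" and ab: "a < b" "H a \<ge> H b"
    and xa: "x \<in> closed_ival H a" and xb: "x \<in> closed_ival H b"
  shows "H a = H b"
proof -
  have le_pp: "pplus H p \<le> ereal q" if "q > p" "H q \<le> H p" for p q
    unfolding pplus_def using that by (auto intro!: Inf_lower)
  have bdd: "bdd_above {q. q < p \<and> H q \<ge> H p}" for p
    by (rule bdd_aboveI[of _ p]) auto
  have ge_pm: "q \<le> pminus H p" if "q < p" "H q \<ge> H p" for p q
    unfolding pminus_def using that bdd by (auto intro!: cSup_upper)
  have "pplus H a \<noteq> -\<infinity>"
  proof -
    have "ereal a \<le> pplus H a" unfolding pplus_def by (auto intro!: Inf_greatest)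
    then show ?thesis by auto
  qed
  with le_pp[OF ab] obtain r where r: "pplus H a = ereal r" by (cases "pplus H a") auto
  have ar: "a \<le> r"
  proof -
    have "ereal a \<le> pplus H a" unfolding pplus_def by (auto intro!: Inf_greatest)
    then show ?thesis by (simp add: r)
  qed
  define s where "s = pminus H b"
  have sb: "s \<le> b"
    unfolding s_def pminus_def using ab by (intro cSup_least) auto
  have sx: "s \<le> x" and xr: "x \<le> r" using xa xb by (auto simp: closed_ival_def s_def r)
  have Hr: "H r \<ge> H a"
  proof (cases "a = r")
    case False
    have "H y \<ge> H a" if "y \<in> {a<..<r}" for y
      using le_pp[of a y] that by (force simp: r)
    moreover have "r \<in> closure {a<..<r}" using False ar by simp
    ultimately show ?thesis
      using H continuous_ge_on_closure[of "{a<..<r}" H r "H a"] continuous_on_subset by blast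
  qed simp
  have Hs: "H s \<le> H b"
  proof (cases "s = b")
    case False
    have "H y \<le> H b" if "y \<in> {s<..<b}" for y
      using ge_pm[of y b] that by (force simp: s_def)
    moreover have "s \<in> closure {s<..<b}" using False sb by simp
    ultimately show ?thesis
      using H continuous_le_on_closure[of "{s<..<b}" H s "H b"] continuous_on_subset by blast
  qed simp
  have "s = r"
  proof (rule ccontr)
    assume "s \<noteq> r"
    then have "s < r" using sx xr by simp
    have as: "a \<le> s" unfolding s_def by (rule ge_pm[OF ab])
    have rb: "r \<le> b" using le_pp[OF ab] by (simp add: r)
    define m where "m = (s + r) / 2"
    have m: "s < m" "m < r" using \<open>s < r\<close> by (auto simp: m_def)
    have "H m > H a" using le_pp[of a m] m as by (force simp: r)
    moreover have "H m < H b" using ge_pm[of m b] m rb by (force simp: s_def)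
    ultimately show False using ab by simp
  qed
  with Hr Hs ab show ?thesis by simp
qed

lemma limited_flux_eq:
  assumes "continuous_on UNIV H" "set_limiter H A" "a \<in> A" "p \<in> closed_ival H a"
  shows "limited_flux H A p = H a"
proof -
  define b where "b = (SOME a. a \<in> A \<and> p \<in> closed_ival H a)"
  have b: "b \<in> A \<and> p \<in> closed_ival H b"
    unfolding b_def by (rule someI[of _ a]) (use assms in auto)
  have le: "H y \<le> H x" if "x \<in> A" "y \<in> A" "x < y" for x y
    using assms(2) that by (auto simp: set_limiter_def)
  have "H a = H b"
  proof (cases a b rule: linorder_cases)
    case less
    show ?thesis
      by (rule set_limiter_value_unique_aux[of _ _ _ p]) (use assms b less le in auto)
  next
    case greater
    have "H b = H a"
      by (rule set_limiter_value_unique_aux[of _ _ _ p]) (use assms b greater le in auto)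
    then show ?thesis by simp
  qed simp
  then show ?thesis
    using assms(3,4) by (auto simp: limited_flux_def b_def)
qed

end

theory Submission
  imports Defs
begin

text \<open>
  The whole proof turns on one property of a slope \<open>p\<close>: that the planar function
  \<open>u(t,x) = p x - H(p) t\<close> is a relaxed solution. It is touched at the boundary from above by test
  functions of slope \<open>q \<ge> p\<close> and from below by those of slope \<open>q \<le> p\<close>, so this means that
  \<open>min (H q) (F q) \<le> H p\<close> for \<open>q \<ge> p\<close> and \<open>H p \<le> max (H q) (F q)\<close> for \<open>q \<le> p\<close>. The set \<open>A_F\<close> consists
  of the slopes with this property for which \<open>p\<^sup>-\<close> and \<open>p\<^sup>+\<close> differ (\<open>A_F_eq\<close>).

  The limited flux. Put \<open>M(p) = inf\<^sub>q\<^sub>\<le>\<^sub>p max (H q) (F q)\<close> and \<open>m(p) = sup\<^sub>q\<^sub>\<ge>\<^sub>p min (H q) (F q)\<close>; then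
  \<open>m \<le> M\<close> because \<open>F\<close> is non-increasing. The flux limited by \<open>A_F\<close> is \<open>H\<close> truncated to the interval
  \<open>[m(p), M(p)]\<close>. Indeed, if \<open>H(p) > M(p)\<close>, then the last point \<open>a\<close> before \<open>p\<close> at which \<open>H\<close> takes the
  value \<open>M(p)\<close> is a planar slope and \<open>p\<close> lies in the interval of \<open>a\<close>; if \<open>H(p) < m(p)\<close>, the first point
  after \<open>p\<close> with \<open>H(a) = m(p)\<close> does the same; otherwise \<open>p\<close> is itself a planar slope
  (\<open>relaxed_slope_cases\<close>). The density condition on set limiters follows from the same trichotomy,
  and the monotonicity condition from the intermediate value theorem for \<open>F\<close>.

  From relaxed to flux-limited. Let \<open>\<phi>\<close> touch \<open>u\<^sup>*\<close> from above at a boundary point, with slope \<open>p\<close> and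
  \<open>\<lambda> = - \<phi>\<^sub>t\<close>. Tilt \<open>\<phi>\<close> to \<open>\<phi> + (q - p) x\<close> and let \<open>p\<^sub>0 \<le> p\<close> be the infimum of the slopes \<open>q\<close> for which
  there still is contact. Just below \<open>p\<^sub>0\<close> the contact point moves into the interior, where the equation
  holds, and in the limit \<open>H(p\<^sub>0) \<le> \<lambda>\<close> (\<open>critical_slope\<close>). Every \<open>q > p\<^sub>0\<close> keeps contact at the boundary,
  so \<open>min (H q) (F q) \<le> \<lambda>\<close>. As \<open>H\<close> and \<open>F\<close> tend to infinity at minus infinity, \<open>p\<^sub>0\<close> is finite. These two facts
  give \<open>m(p) \<le> \<lambda>\<close> and \<open>min (H p) (M p) \<le> \<lambda>\<close>, that is, the flux-limited inequality
  (\<open>limited_flux_le\<close>). Supersolutions become subsolutions under \<open>u \<mapsto> -u\<close>, \<open>H \<mapsto> -H(-\<cdot>)\<close>; the critical slope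
  argument survives this because it does not involve coercivity.

  Uniqueness. If every relaxed solution is flux-limited for a set limiter \<open>A\<close>, apply this to the planar
  solutions with slope \<open>p \<in> A_F\<close>: the flux limited by \<open>A\<close> is at most \<open>H(p)\<close> on the right of \<open>p\<close> and at least
  \<open>H(p)\<close> on the left. By density some interval of a point of \<open>A\<close> meets the one of \<open>p\<close>, and the
  bounds leave only \<open>p\<close> itself as that point. Hence \<open>A_F \<subseteq> A\<close>; since the open intervals of distinct points of
  a set limiter are disjoint, density of \<open>A_F\<close> leaves no room for further points (\<open>set_limiter_eqI\<close>).
\<close>

section \<open>Level crossings and the numbers $p^-$ and $p^+$\<close>

lemma first_hit:
  fixes H :: "real \<Rightarrow> real"
  assumes "continuous_on UNIV H" "p \<le> q" "H p < m" "m \<le> H q"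
  obtains a where "p < a" "a \<le> q" "H a = m" "\<And>r. p \<le> r \<Longrightarrow> r < a \<Longrightarrow> H r < m"
proof -
  have cont: "continuous_on S H" for S
    using assms(1) continuous_on_subset by blast
  let ?S = "{p..q} \<inter> H -` {m..}"
  have "compact ?S"
    using closed_vimage[OF closed_atLeast[of m] assms(1)] by (intro compact_Int_closed) auto
  moreover have "?S \<noteq> {}"
    using assms by auto
  ultimately obtain a where a: "a \<in> ?S" "\<And>r. r \<in> ?S \<Longrightarrow> a \<le> r"
    using compact_attains_inf by metis
  have less: "H r < m" if "p \<le> r" "r < a" for r
    using a(2)[of r] a(1) that by force
  have "H a = m"
  proof (rule ccontr)
    assume "H a \<noteq> m"
    then have "m < H a" using a(1) by auto
    then obtain r where "p \<le> r" "r \<le> a" "H r = m"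
      using IVT'[of H p m a] a(1) assms cont by auto
    then show False
      using less[of r] \<open>H a \<noteq> m\<close> by (cases "r = a") auto
  qed
  with a less assms that[of a] show ?thesis
    by (metis Int_iff atLeastAtMost_iff less_le order_less_irrefl)
qed

lemma last_hit:
  fixes H :: "real \<Rightarrow> real"
  assumes "continuous_on UNIV H" "q \<le> p" "m < H p" "H q \<le> m"
  obtains a where "q \<le> a" "a < p" "H a = m" "\<And>r. a < r \<Longrightarrow> r \<le> p \<Longrightarrow> m < H r"
proof -
  have "continuous_on UNIV (\<lambda>s. - H (- s))"
    by (intro continuous_intros continuous_on_compose2[OF assms(1)]) auto
  from first_hit[OF this, of "- p" "- q" "- m"] assms obtain a
    where a: "- p < a" "a \<le> - q" "H (- a) = m" "\<And>r. - p \<le> r \<Longrightarrow> r < a \<Longrightarrow> m < H (- r)"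
    by (smt (verit) minus_minus)
  show thesis
    by (rule that[of "- a"]) (use a a(4)[of "- r" for r] in auto)
qed

lemma pplus_ge: "ereal p \<le> pplus H p"
  unfolding pplus_def by (auto intro!: Inf_greatest)

lemma pplus_le: "p < q \<Longrightarrow> H q \<le> H p \<Longrightarrow> pplus H p \<le> ereal q"
  unfolding pplus_def by (auto intro!: Inf_lower)

lemma pplus_greatest:
  "(\<And>r. p < r \<Longrightarrow> ereal r < s \<Longrightarrow> H p < H r) \<Longrightarrow> s \<le> pplus H p"
  unfolding pplus_def by (intro Inf_greatest) (force simp: not_less[symmetric])

lemma above_right: "p < r \<Longrightarrow> ereal r < pplus H p \<Longrightarrow> H p < H r"
  using pplus_le[of p r H] by force

lemma pminus_ge: "q < p \<Longrightarrow> H p \<le> H q \<Longrightarrow> q \<le> pminus H p"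
  unfolding pminus_def by (auto intro!: cSup_upper bdd_aboveI[of _ p])

lemma below_left: "r < p \<Longrightarrow> pminus H p < r \<Longrightarrow> H r < H p"
  using pminus_ge[of r p H] by force

text \<open>Divergence of \<open>H\<close> at minus infinity makes the set whose supremum is \<open>p\<^sup>-\<close> nonempty, so the
  least upper bound property applies to this real supremum.\<close>
lemma pminus_least:
  fixes H :: "real \<Rightarrow> real"
  assumes "filterlim H at_top at_bot" "s \<le> p" "\<And>r. s < r \<Longrightarrow> r < p \<Longrightarrow> H r < H p"
  shows "pminus H p \<le> s"
  unfolding pminus_def
proof (rule cSup_least)
  have "eventually (\<lambda>q. H p \<le> H q) at_bot"
    using assms(1) by (auto simp: filterlim_at_top)
  then obtain N where "\<And>q. q \<le> N \<Longrightarrow> H p \<le> H q"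
    by (auto simp: eventually_at_bot_linorder)
  then have "min N (p - 1) \<in> {q. q < p \<and> H p \<le> H q}"
    by auto
  then show "{q. q < p \<and> H p \<le> H q} \<noteq> {}"
    by blast
qed (use assms(3) in force)

text \<open>The end points of the closed interval are covered by continuity: a strict inequality in the wrong direction
  would persist at nearby points and move the end point inwards.\<close>
lemma closed_ival_right_ge:
  assumes "continuous_on UNIV H" "p \<in> closed_ival H a" "a < p"
  shows "H a \<le> H p"
proof (rule ccontr)
  assume "\<not> H a \<le> H p"
  moreover have "isCont H p"
    using assms(1) by (simp add: continuous_on_eq_continuous_at)
  ultimately have "eventually (\<lambda>r. H r < H a) (at_left p)"
    using order_tendstoD(2)[of H "H p" "at p" "H a"] filterlim_at_split[of H "nhds (H p)" p]
    by (auto simp: isCont_def order_tendsto_iff)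
  moreover have "eventually (\<lambda>r. a < r \<and> r < p) (at_left p)"
    using assms(3) eventually_at_left_real[of a p] by (simp add: greaterThanLessThan_def)
  ultimately have "eventually (\<lambda>r. H r < H a \<and> a < r \<and> r < p) (at_left p)"
    by eventually_elim auto
  then obtain r where "H r < H a" "a < r" "r < p"
    by (auto dest!: eventually_happens simp: trivial_limit_at_left_real)
  then show False
    using pplus_le[of a r H] assms(2) by (auto simp: closed_ival_def dest: order_trans)
qed

lemma closed_ival_left_le:
  assumes "continuous_on UNIV H" "p \<in> closed_ival H a" "p < a"
  shows "H p \<le> H a"
proof (rule ccontr)
  assume "\<not> H p \<le> H a"
  moreover have "isCont H p"
    using assms(1) by (simp add: continuous_on_eq_continuous_at)
  ultimately have "eventually (\<lambda>r. H a < H r) (at_right p)"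
    using filterlim_at_split[of H "nhds (H p)" p]
    by (auto simp: isCont_def order_tendsto_iff)
  moreover have "eventually (\<lambda>r. p < r \<and> r < a) (at_right p)"
    using assms(3) eventually_at_right_real[of p a] by (simp add: greaterThanLessThan_def)
  ultimately have "eventually (\<lambda>r. H a < H r \<and> p < r \<and> r < a) (at_right p)"
    by eventually_elim auto
  then obtain r where "H a < H r" "p < r" "r < a"
    by (auto dest!: eventually_happens simp: trivial_limit_at_right_real)
  then show False
    using pminus_ge[of r a H] assms(2) by (auto simp: closed_ival_def)
qed

section \<open>The slopes of planar relaxed solutions\<close>

text \<open>These are the slopes \<open>p\<close> for which \<open>(t, x) \<mapsto> p x - H(p) t\<close> satisfies the relaxed boundary condition:
  the two parts are the conditions for test functions from above and from below.\<close>
definition relaxed_slope :: "(real \<Rightarrow> real) \<Rightarrow> (real \<Rightarrow> real) \<Rightarrow> real \<Rightarrow> bool" where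
  "relaxed_slope H F p \<longleftrightarrow>
     (\<forall>q\<ge>p. min (H q) (F q) \<le> H p) \<and> (\<forall>q\<le>p. H p \<le> max (H q) (F q))"

text \<open>Coercivity of \<open>H\<close> is split into its two directions, which enter at different places.\<close>
locale boundary_flux =
  fixes H F :: "real \<Rightarrow> real"
  assumes contH: "continuous_on UNIV H" and Hbot: "filterlim H at_top at_bot"
    and Htop: "filterlim H at_top at_top"
    and contF: "continuous_on UNIV F" and antiF: "antimono F"
begin

lemma F_mono: "p \<le> q \<Longrightarrow> F q \<le> F p"
  using antiF by (simp add: antimonoD)

lemma pminus_le: "pminus H p \<le> p"
  by (rule pminus_least[OF Hbot]) auto

text \<open>If \<open>H q > H p\<close>, then at each point between \<open>p\<close> and \<open>q\<close> the two conditions leave the alternative of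
  \<open>F \<le> H p\<close> or \<open>F \<ge> H q\<close>. At the end points different alternatives hold, so the continuous
  function \<open>F\<close> would have to jump.\<close>
lemma relaxed_slope_antimono:
  assumes "relaxed_slope H F p" "relaxed_slope H F q" "p < q"
  shows "H q \<le> H p"
proof (rule ccontr)
  assume less: "\<not> H q \<le> H p"
  have alt: "(H r \<le> H p \<or> F r \<le> H p) \<and> (H q \<le> H r \<or> H q \<le> F r)" if "p \<le> r" "r \<le> q" for r
    using assms that by (auto simp: relaxed_slope_def min_le_iff_disj le_max_iff_disj)
  have "H q \<le> F p" "F q \<le> H p"
    using alt[of p] alt[of q] less assms(3) by auto
  moreover have "continuous_on {p..q} F"
    using contF continuous_on_subset by blast
  ultimately obtain r where r: "p \<le> r" "r \<le> q" "F r = (H p + H q) / 2"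
    using IVT2'[of F q "(H p + H q) / 2" p] assms(3) less by auto
  then show False
    using alt[of r] less by auto
qed

lemma F_ge_if_ge_on_left:
  assumes "s < p" "\<And>r. s < r \<Longrightarrow> r < p \<Longrightarrow> c \<le> F r"
  shows "c \<le> F p"
proof -
  have "isCont F p"
    using contF by (simp add: continuous_on_eq_continuous_at)
  then have "(F \<longlongrightarrow> F p) (at_left p)"
    using filterlim_at_split isCont_def by blast
  moreover have "eventually (\<lambda>r. c \<le> F r) (at_left p)"
    using eventually_at_left_real[OF assms(1)] by eventually_elim (use assms in auto)
  ultimately show ?thesis
    by (intro tendsto_lowerbound[of F "F p" "at_left p"]) auto
qed

lemma F_le_if_le_on_right:
  assumes "p < s" "\<And>r. p < r \<Longrightarrow> r < s \<Longrightarrow> F r \<le> c"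
  shows "F p \<le> c"
proof -
  have "isCont F p"
    using contF by (simp add: continuous_on_eq_continuous_at)
  then have "(F \<longlongrightarrow> F p) (at_right p)"
    using filterlim_at_split isCont_def by blast
  moreover have "eventually (\<lambda>r. F r \<le> c) (at_right p)"
    using eventually_at_right_real[OF assms(1)] by eventually_elim (use assms in auto)
  ultimately show ?thesis
    by (intro tendsto_upperbound[of F "F p" "at_right p"]) auto
qed

text \<open>In case (a) of the definition only the condition for slopes \<open>q \<ge> p\<close> is in question. If it failed at \<open>q\<close>
  with \<open>m = min (H q) (F q) > H p\<close>, then \<open>H\<close> would reach the level \<open>m\<close> for the first time after
  \<open>p\<close> at some \<open>q' \<le> q\<close>. There \<open>F q' \<ge> F q \<ge> H q'\<close>, and the interval of \<open>q'\<close> contains \<open>(p\<^sup>-, p)\<close>, on which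
  \<open>H\<close> is even smaller; so \<open>q'\<close> violates the maximality in (a). Case (b) is symmetric.\<close>
lemma A_F_imp_relaxed_slope:
  assumes "p \<in> A_F H F"
  shows "relaxed_slope H F p"
proof -
  consider
    (a) "pminus H p \<noteq> p" "F p \<ge> H p"
      "\<And>q. F q \<ge> H q \<Longrightarrow> open_ival H q \<inter> left_ival H p \<noteq> {} \<Longrightarrow> H q \<le> H p"
  | (b) "pplus H p \<noteq> ereal p" "F p \<le> H p"
      "\<And>q. F q \<le> H q \<Longrightarrow> open_ival H q \<inter> right_ival H p \<noteq> {} \<Longrightarrow> H q \<ge> H p"
    using assms unfolding A_F_def by blast
  then show ?thesis
  proof cases
    case a
    have lt: "pminus H p < p" using a(1) pminus_le[of p] by simp
    have "min (H q) (F q) \<le> H p" if pq: "p \<le> q" for q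
    proof (rule ccontr)
      assume n: "\<not> min (H q) (F q) \<le> H p"
      define m where "m = min (H q) (F q)"
      obtain q' where q': "p < q'" "q' \<le> q" "H q' = m"
        and below: "\<And>r. p \<le> r \<Longrightarrow> r < q' \<Longrightarrow> H r < m"
        by (rule first_hit[OF contH pq, of m]) (use n in \<open>auto simp: m_def\<close>)
      have "H r < m" if "pminus H p < r" "r < q'" for r
        using below[of r] below_left[of r p H] that n by (fastforce simp: m_def)
      then have "pminus H q' \<le> pminus H p"
        using lt q' pminus_least[OF Hbot, of "pminus H p" q'] by auto
      moreover have "ereal p < pplus H q'"
        using pplus_ge[of q' H] q'(1) by (metis less_ereal.simps(1) order_less_le_trans)
      ultimately have "(pminus H p + p) / 2 \<in> open_ival H q' \<inter> left_ival H p"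
        using lt by (auto simp: open_ival_def left_ival_def elim!: order_le_less_trans[rotated])
      moreover have "F q' \<ge> H q'"
        using F_mono[OF q'(2)] q'(3) by (simp add: m_def)
      ultimately have "H q' \<le> H p" using a(3) by blast
      then show False using q' n by (simp add: m_def)
    qed
    moreover have "H p \<le> max (H q) (F q)" if "q \<le> p" for q
      using F_mono[OF that] a(2) by simp
    ultimately show ?thesis by (simp add: relaxed_slope_def)
  next
    case b
    have lt: "ereal p < pplus H p" using b(1) pplus_ge[of p H] by (simp add: less_le)
    have "H p \<le> max (H q) (F q)" if qp: "q \<le> p" for q
    proof (rule ccontr)
      assume n: "\<not> H p \<le> max (H q) (F q)"
      define m where "m = max (H q) (F q)"
      obtain q' where q': "q \<le> q'" "q' < p" "H q' = m"
        and above: "\<And>r. q' < r \<Longrightarrow> r \<le> p \<Longrightarrow> m < H r"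
        by (rule last_hit[OF contH qp, of m]) (use n in \<open>auto simp: m_def\<close>)
      have "m < H r" if "q' < r" "ereal r < pplus H p" for r
        using above[of r] above_right[of p r H] that n by (fastforce simp: m_def)
      then have le: "pplus H p \<le> pplus H q'"
        using q'(3) by (intro pplus_greatest) auto
      obtain r where r: "p < r" "ereal r < pplus H p"
        using ereal_dense2[OF lt] by auto
      moreover have "pminus H q' < r"
        using pminus_le[of q'] q'(2) r(1) by simp
      ultimately have "r \<in> open_ival H q' \<inter> right_ival H p"
        using le by (auto simp: open_ival_def right_ival_def)
      moreover have "F q' \<le> H q'"
        using F_mono[OF q'(1)] q'(3) by (simp add: m_def)
      ultimately have "H p \<le> H q'" using b(3) by blast
      then show False using q' n by (simp add: m_def)
    qed
    moreover have "min (H q) (F q) \<le> H p" if "p \<le> q" for q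
      using F_mono[OF that] b(2) by simp
    ultimately show ?thesis by (simp add: relaxed_slope_def)
  qed
qed

text \<open>For the converse the sign of \<open>F p - H p\<close> has to be recovered: on \<open>(p\<^sup>-, p)\<close> one has \<open>H < H p\<close>, so the
  condition from below forces \<open>F \<ge> H p\<close> there and, by continuity, at \<open>p\<close>. A slope \<open>q\<close> that violates the maximality
  in (a) has \<open>q < p\<close> and \<open>H q > H p\<close>, hence \<open>q \<le> p\<^sup>-\<close>; at a common point \<open>r\<close> of the two intervals this would give
  \<open>H r > H q > H p > H r\<close>.\<close>
lemma A_F_eq: "A_F H F = {p. ereal (pminus H p) \<noteq> pplus H p \<and> relaxed_slope H F p}"
proof (intro equalityI subsetI)
  fix p assume p: "p \<in> A_F H F"
  then have "pminus H p \<noteq> p \<or> pplus H p \<noteq> ereal p" by (auto simp: A_F_def)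
  then have "ereal (pminus H p) \<noteq> pplus H p"
    using pminus_le[of p] pplus_ge[of p H] by (cases "pplus H p") auto
  with A_F_imp_relaxed_slope[OF p] show "p \<in> {p. ereal (pminus H p) \<noteq> pplus H p \<and> relaxed_slope H F p}"
    by simp
next
  fix p assume "p \<in> {p. ereal (pminus H p) \<noteq> pplus H p \<and> relaxed_slope H F p}"
  then have ne: "ereal (pminus H p) \<noteq> pplus H p"
    and R1: "\<And>q. p \<le> q \<Longrightarrow> H q \<le> H p \<or> F q \<le> H p"
    and R2: "\<And>q. q \<le> p \<Longrightarrow> H p \<le> H q \<or> H p \<le> F q"
    by (auto simp: relaxed_slope_def min_le_iff_disj le_max_iff_disj)
  show "p \<in> A_F H F"
  proof (cases "pminus H p = p")
    case False
    then have lt: "pminus H p < p" using pminus_le[of p] by simp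
    have "H p \<le> F p"
      using R2 below_left[of _ p H] by (intro F_ge_if_ge_on_left[OF lt]) (meson less_imp_le not_le)
    moreover have "H q \<le> H p"
      if "F q \<ge> H q" and int: "open_ival H q \<inter> left_ival H p \<noteq> {}" for q
    proof (rule ccontr)
      assume n: "\<not> H q \<le> H p"
      then have "q < p" using R1[of q] that(1) by force
      then have "q \<le> pminus H p" using n by (intro pminus_ge) auto
      moreover obtain r where r: "ereal r < pplus H q" "pminus H p < r" "r < p"
        using int by (auto simp: open_ival_def left_ival_def)
      ultimately show False
        using above_right[of q r H] below_left[of r p H] n by auto
    qed
    ultimately show ?thesis using False by (auto simp: A_F_def)
  next
    case True
    then have lt: "ereal p < pplus H p"
      using ne pplus_ge[of p H] by (simp add: less_le)
    obtain s where s: "p < s" "ereal s < pplus H p"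
      using ereal_dense2[OF lt] by auto
    have "H p < H r" if "p < r" "r < s" for r
      using above_right[of p r H] that s by (meson less_ereal.simps(1) order_less_trans)
    then have "F p \<le> H p"
      using R1 by (intro F_le_if_le_on_right[OF s(1)]) (meson less_imp_le not_le)
    moreover have "H q \<ge> H p"
      if "F q \<le> H q" and int: "open_ival H q \<inter> right_ival H p \<noteq> {}" for q
    proof (rule ccontr)
      assume n: "\<not> H q \<ge> H p"
      then have "p < q" using R2[of q] that(1) by force
      then have "pplus H p \<le> ereal q" using n by (intro pplus_le) auto
      moreover obtain r where r: "pminus H q < r" "ereal r < pplus H p" "p < r"
        using int by (auto simp: open_ival_def right_ival_def)
      ultimately have "r < q" by (metis less_ereal.simps(1) order_less_le_trans)
      then show False
        using above_right[of p r H] below_left[of r q H] n r by auto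
    qed
    ultimately show ?thesis using lt by (auto simp: A_F_def)
  qed
qed

lemma min_max_attained: "\<exists>q\<le>p. \<forall>r\<le>p. max (H q) (F q) \<le> max (H r) (F r)"
proof -
  have "eventually (\<lambda>q. max (H p) (F p) \<le> H q) at_bot"
    using Hbot unfolding filterlim_at_top by blast
  then obtain N where N: "\<And>q. q \<le> N \<Longrightarrow> max (H p) (F p) \<le> H q"
    by (auto simp: eventually_at_bot_linorder)
  let ?K = "{min N p..p}"
  have "continuous_on ?K (\<lambda>r. max (H r) (F r))"
    by (intro continuous_intros continuous_on_subset[OF contH] continuous_on_subset[OF contF]) auto
  then obtain q where q: "q \<in> ?K" "\<And>r. r \<in> ?K \<Longrightarrow> max (H q) (F q) \<le> max (H r) (F r)"
    using continuous_attains_inf[of ?K "\<lambda>r. max (H r) (F r)"] by auto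
  have "max (H q) (F q) \<le> max (H r) (F r)" if "r \<le> p" for r
    using q(2)[of r] q(2)[of p] N[of r] that by (cases "r \<le> N") auto
  then show ?thesis using q(1) by auto
qed

text \<open>At a point \<open>N\<close> with \<open>H N \<ge> F p\<close> the minimum is \<open>F N\<close>, which bounds all later values since \<open>F\<close> is
  non-increasing; so it suffices to maximize over \<open>[p, N]\<close>.\<close>
lemma max_min_attained: "\<exists>q\<ge>p. \<forall>r\<ge>p. min (H r) (F r) \<le> min (H q) (F q)"
proof -
  have "eventually (\<lambda>q. F p \<le> H q \<and> p \<le> q) at_top"
    using Htop by (intro eventually_conj eventually_ge_at_top) (auto simp: filterlim_at_top)
  then obtain N where N: "F p \<le> H N" "p \<le> N"
    by (auto dest!: eventually_happens)
  let ?K = "{p..N}"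
  have "continuous_on ?K (\<lambda>r. min (H r) (F r))"
    by (intro continuous_intros continuous_on_subset[OF contH] continuous_on_subset[OF contF]) auto
  then obtain q where q: "q \<in> ?K" "\<And>r. r \<in> ?K \<Longrightarrow> min (H r) (F r) \<le> min (H q) (F q)"
    using continuous_attains_sup[of ?K "\<lambda>r. min (H r) (F r)"] N(2) by auto
  have "min (H r) (F r) \<le> min (H q) (F q)" if "r \<ge> p" for r
  proof (cases "r \<le> N")
    case False
    then have "F r \<le> F N" "F N \<le> F p" using F_mono N(2) by auto
    then show ?thesis using q(2)[of N] N by auto
  qed (use q that in auto)
  then show ?thesis using q(1) by auto
qed

text \<open>The three cases are \<open>H p > M\<close>, \<open>H p < m\<close> and \<open>m \<le> H p \<le> M\<close>, where \<open>M\<close> is the least value of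
  \<open>max (H q) (F q)\<close> over \<open>q \<le> p\<close> and \<open>m\<close> the largest value of \<open>min (H q) (F q)\<close> over \<open>q \<ge> p\<close>. In the first case
  \<open>a\<close> is the last crossing of the level \<open>M\<close> before \<open>p\<close>. It lies on the right of a minimizer \<open>q\<close>,
  whence \<open>F \<le> F q \<le> M = H a\<close> from \<open>a\<close> on, and this is the condition on larger slopes.\<close>
lemma relaxed_slope_cases:
  obtains
    (left) a q where "relaxed_slope H F a" "a < p" "\<And>r. a < r \<Longrightarrow> r \<le> p \<Longrightarrow> H a < H r"
      "q \<le> p" "max (H q) (F q) = H a" "\<And>r. r \<le> p \<Longrightarrow> H a \<le> max (H r) (F r)"
  | (right) a q where "relaxed_slope H F a" "p < a" "\<And>r. p \<le> r \<Longrightarrow> r < a \<Longrightarrow> H r < H a"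
      "p \<le> q" "min (H q) (F q) = H a" "\<And>r. p \<le> r \<Longrightarrow> min (H r) (F r) \<le> H a"
  | (self) "relaxed_slope H F p"
proof -
  obtain q where q: "q \<le> p" "\<And>r. r \<le> p \<Longrightarrow> max (H q) (F q) \<le> max (H r) (F r)"
    using min_max_attained by blast
  obtain s where s: "p \<le> s" "\<And>r. r \<ge> p \<Longrightarrow> min (H r) (F r) \<le> min (H s) (F s)"
    using max_min_attained by blast
  consider "max (H q) (F q) < H p" | "H p < min (H s) (F s)"
    | "H p \<le> max (H q) (F q)" "min (H s) (F s) \<le> H p" by linarith
  then show thesis
  proof cases
    case 1
    obtain a where
      a: "q \<le> a" "a < p" "H a = max (H q) (F q)"
        "\<And>r. a < r \<Longrightarrow> r \<le> p \<Longrightarrow> max (H q) (F q) < H r"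
      by (rule last_hit[OF contH q(1) 1 max.cobounded1]) (rule that; assumption)
    have "min (H r) (F r) \<le> H a" if "a \<le> r" for r
      using F_mono[of q r] a that by auto
    then have "relaxed_slope H F a"
      using q(2) a(2,3) by (auto simp: relaxed_slope_def)
    then show ?thesis
      by (rule left[OF _ a(2) _ q(1) a(3)[symmetric]]) (use a(3,4) q(2) in auto)
  next
    case 2
    obtain a where
      a: "p < a" "a \<le> s" "H a = min (H s) (F s)"
        "\<And>r. p \<le> r \<Longrightarrow> r < a \<Longrightarrow> H r < min (H s) (F s)"
      by (rule first_hit[OF contH s(1) 2 min.cobounded1]) (rule that; assumption)
    have "H a \<le> max (H r) (F r)" if "r \<le> a" for r
      using F_mono[of r s] a that by auto
    then have "relaxed_slope H F a"
      using s(2) a(1,3) by (auto simp: relaxed_slope_def)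
    then show ?thesis
      by (rule right[OF _ a(1) _ s(1) a(3)[symmetric]]) (use a(3,4) s(2) in auto)
  next
    case 3
    have "min (H r) (F r) \<le> H p" if "p \<le> r" for r
      using s(2)[OF that] 3(2) by linarith
    moreover have "H p \<le> max (H r) (F r)" if "r \<le> p" for r
      using q(2)[OF that] 3(1) by linarith
    ultimately have "relaxed_slope H F p"
      by (simp add: relaxed_slope_def)
    then show ?thesis by (rule self)
  qed
qed

lemma left_pplus_ge:
  assumes "\<And>r. a < r \<Longrightarrow> r \<le> p \<Longrightarrow> H a < H r" shows "ereal p \<le> pplus H a"
  using assms by (intro pplus_greatest) auto

lemma right_pminus_le:
  assumes "p < a" "\<And>r. p \<le> r \<Longrightarrow> r < a \<Longrightarrow> H r < H a" shows "pminus H a \<le> p"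
  using assms by (intro pminus_least[OF Hbot, of p a]) auto

section \<open>$A_F$ as a set limiter, and its limited flux\<close>

text \<open>The density condition at \<open>p\<close> is met by the point that \<open>relaxed_slope_cases\<close> provides for \<open>p\<close>:
  its open interval contains a neighbourhood of \<open>p\<close> on the relevant side, or all of the interval of \<open>p\<close>
  on that side, because \<open>H\<close> stays on one side of \<open>H a\<close> there.\<close>
lemma set_limiter_A_F: "set_limiter H (A_F H F)"
  unfolding set_limiter_def
proof (intro conjI ballI allI impI)
  fix p assume lt: "pminus H p < p"
  show "\<exists>a\<in>A_F H F. left_ival H p \<inter> open_ival H a \<noteq> {}"
  proof (rule relaxed_slope_cases[of p])
    fix a assume a: "relaxed_slope H F a" "a < p" "\<And>r. a < r \<Longrightarrow> r \<le> p \<Longrightarrow> H a < H r"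
    have pp: "ereal p \<le> pplus H a" using a(3) by (rule left_pplus_ge)
    have am: "pminus H a \<le> a" by (rule pminus_le)
    obtain r where r: "max a (pminus H p) < r" "r < p" using dense[of "max a (pminus H p)" p] a lt by auto
    have "ereal r < pplus H a" using pp r(2) by (meson less_ereal.simps(1) order_less_le_trans)
    then have "r \<in> left_ival H p \<inter> open_ival H a"
      using r am by (auto simp: left_ival_def open_ival_def)
    moreover have "a \<in> A_F H F"
      using a am pp by (cases "pplus H a") (auto simp: A_F_eq)
    ultimately show ?thesis by blast
  next
    fix a assume a: "relaxed_slope H F a" "p < a" "\<And>r. p \<le> r \<Longrightarrow> r < a \<Longrightarrow> H r < H a"
    have "H r < H a" if "pminus H p < r" "r < a" for r
      using a(3)[of r] a(3)[of p] below_left[of r p H] that a(2) by fastforce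
    then have am: "pminus H a \<le> pminus H p"
      using lt a(2) pminus_least[OF Hbot, of "pminus H p" a] by auto
    have pp: "ereal a \<le> pplus H a" by (rule pplus_ge)
    obtain r where r: "pminus H p < r" "r < p" using dense[OF lt] by auto
    have "ereal r < pplus H a" using pp r(2) a(2)
      by (meson less_ereal.simps(1) order_less_le_trans order_less_trans)
    then have "r \<in> left_ival H p \<inter> open_ival H a"
      using r am by (auto simp: left_ival_def open_ival_def)
    moreover have "a \<in> A_F H F"
      using a am pp lt by (cases "pplus H a") (auto simp: A_F_eq)
    ultimately show ?thesis by blast
  next
    assume p: "relaxed_slope H F p"
    have pp: "ereal p \<le> pplus H p" by (rule pplus_ge)
    obtain r where r: "pminus H p < r" "r < p" using dense[OF lt] by auto
    have "ereal r < pplus H p" using pp r(2) by (meson less_ereal.simps(1) order_less_le_trans)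
    then have "r \<in> left_ival H p \<inter> open_ival H p"
      using r by (auto simp: left_ival_def open_ival_def)
    moreover have "p \<in> A_F H F"
      using p pp lt by (cases "pplus H p") (auto simp: A_F_eq)
    ultimately show ?thesis by blast
  qed
next
  fix p assume lt: "ereal p < pplus H p"
  show "\<exists>a\<in>A_F H F. right_ival H p \<inter> open_ival H a \<noteq> {}"
  proof (rule relaxed_slope_cases[of p])
    fix a assume a: "relaxed_slope H F a" "a < p" "\<And>r. a < r \<Longrightarrow> r \<le> p \<Longrightarrow> H a < H r"
    have "H a < H r" if "a < r" "ereal r < pplus H p" for r
      using a(3)[of r] a(3)[of p] above_right[of p r H] that a(2) by fastforce
    then have pp: "pplus H p \<le> pplus H a"
      by (intro pplus_greatest) auto
    have am: "pminus H a \<le> a" by (rule pminus_le)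
    obtain r where r: "p < r" "ereal r < pplus H p" using ereal_dense2[OF lt] by auto
    have "r \<in> right_ival H p \<inter> open_ival H a"
      using r am pp a(2) by (auto simp: right_ival_def open_ival_def)
    moreover have "ereal a < pplus H a"
      using a(2) lt pp by (meson less_ereal.simps(1) order_less_le_trans order_less_trans)
    then have "a \<in> A_F H F"
      using a am by (cases "pplus H a") (auto simp: A_F_eq)
    ultimately show ?thesis by blast
  next
    fix a assume a: "relaxed_slope H F a" "p < a" "\<And>r. p \<le> r \<Longrightarrow> r < a \<Longrightarrow> H r < H a"
    have am: "pminus H a \<le> p" by (rule right_pminus_le) (use a in auto)
    have pp: "ereal a \<le> pplus H a" by (rule pplus_ge)
    have "ereal p < min (pplus H p) (ereal a)" using lt a(2) by simp
    then obtain r where r: "p < r" "ereal r < pplus H p" "r < a"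
      using ereal_dense2[of "ereal p" "min (pplus H p) (ereal a)"] by auto
    have "ereal r < pplus H a" using pp r(3) by (meson less_ereal.simps(1) order_less_le_trans)
    then have "r \<in> right_ival H p \<inter> open_ival H a"
      using r am by (auto simp: right_ival_def open_ival_def)
    moreover have "a \<in> A_F H F"
      using a am pp by (cases "pplus H a") (auto simp: A_F_eq)
    ultimately show ?thesis by blast
  next
    assume p: "relaxed_slope H F p"
    have am: "pminus H p \<le> p" by (rule pminus_le)
    obtain r where r: "p < r" "ereal r < pplus H p" using ereal_dense2[OF lt] by auto
    have "r \<in> right_ival H p \<inter> open_ival H p"
      using r am by (auto simp: right_ival_def open_ival_def)
    moreover have "p \<in> A_F H F"
      using p am lt by (cases "pplus H p") (auto simp: A_F_eq)
    ultimately show ?thesis by blast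
  qed
qed (auto simp: A_F_eq intro: relaxed_slope_antimono)

abbreviation G :: "real \<Rightarrow> real" where "G \<equiv> limited_flux H (A_F H F)"

lemma limited_flux_left:
  assumes "relaxed_slope H F a" "a < p" "\<And>r. a < r \<Longrightarrow> r \<le> p \<Longrightarrow> H a < H r"
  shows "G p = H a"
proof (rule limited_flux_eq[OF contH set_limiter_A_F])
  have "ereal p \<le> pplus H a" using assms(3) by (rule left_pplus_ge)
  then show "p \<in> closed_ival H a" "a \<in> A_F H F"
    using assms(1,2) pminus_le[of a] by (cases "pplus H a"; auto simp: A_F_eq closed_ival_def)+
qed

lemma limited_flux_right:
  assumes "relaxed_slope H F a" "p < a" "\<And>r. p \<le> r \<Longrightarrow> r < a \<Longrightarrow> H r < H a"
  shows "G p = H a"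
proof (rule limited_flux_eq[OF contH set_limiter_A_F])
  have "pminus H a \<le> p" by (rule right_pminus_le) (use assms in auto)
  then show "p \<in> closed_ival H a" "a \<in> A_F H F"
    using assms(1,2) pplus_ge[of a H] by (cases "pplus H a"; auto simp: A_F_eq closed_ival_def)+
qed

text \<open>Such a \<open>p\<close> can lie in the interval of another point \<open>a\<close> of \<open>A_F\<close>. On that interval \<open>H - H a\<close> is nonnegative to
  the right of \<open>a\<close> and nonpositive to its left, whereas \<open>H\<close> is antitone on planar slopes, so both values agree.\<close>
lemma limited_flux_relaxed_slope:
  assumes "relaxed_slope H F p"
  shows "G p = H p"
proof (cases "\<exists>a\<in>A_F H F. p \<in> closed_ival H a")
  case True
  then obtain a where a: "a \<in> A_F H F" "p \<in> closed_ival H a" by blast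
  then have Ra: "relaxed_slope H F a" by (simp add: A_F_eq)
  have "H a = H p"
  proof (cases a p rule: linorder_cases)
    case less
    then show ?thesis
      using closed_ival_right_ge[OF contH a(2)] relaxed_slope_antimono[OF Ra assms] by simp
  next
    case greater
    then show ?thesis
      using closed_ival_left_le[OF contH a(2)] relaxed_slope_antimono[OF assms Ra] by simp
  qed simp
  with limited_flux_eq[OF contH set_limiter_A_F a] show ?thesis by simp
qed (simp add: limited_flux_def)

text \<open>With \<open>M\<close> and \<open>m\<close> as in the cases for slopes, the limited flux is \<open>H p\<close> truncated to \<open>[m, M]\<close>; as \<open>m \<le> l\<close> is immediate, only
  the case \<open>H p > l\<close> needs an argument for \<open>M \<le> l\<close>. The last point between \<open>p0\<close> and \<open>p\<close> with \<open>H = l\<close>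
  is followed by points with \<open>H > l\<close>, where the hypothesis leaves \<open>F \<le> l\<close>; by continuity
  \<open>max (H q) (F q) \<le> l\<close> there.\<close>
lemma limited_flux_le:
  assumes p0: "p0 \<le> p" "H p0 \<le> l" and min: "\<And>q. p0 \<le> q \<Longrightarrow> min (H q) (F q) \<le> l"
  shows "G p \<le> l"
proof -
  have cross: "\<exists>q\<le>p. max (H q) (F q) \<le> l" if gt: "l < H p"
  proof -
    obtain q where q: "p0 \<le> q" "q < p" "H q = l" "\<And>r. q < r \<Longrightarrow> r \<le> p \<Longrightarrow> l < H r"
      using last_hit[OF contH p0(1) gt p0(2)] by blast
    have "F r \<le> l" if "q < r" "r < p" for r
      using min[of r] q(1) q(4)[of r] that by auto
    then have "F q \<le> l" by (rule F_le_if_le_on_right[OF q(2)])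
    with q show ?thesis by (intro exI[of _ q]) auto
  qed
  show ?thesis
  proof (rule relaxed_slope_cases[of p])
    fix a q assume a: "relaxed_slope H F a" "a < p" "\<And>r. a < r \<Longrightarrow> r \<le> p \<Longrightarrow> H a < H r"
      and least: "\<And>r. r \<le> p \<Longrightarrow> H a \<le> max (H r) (F r)"
    show ?thesis
      using limited_flux_left[OF a] cross least a(3)[of p] a(2)
      by (cases "l < H p") (fastforce dest: order_trans)+
  next
    fix a q assume a: "relaxed_slope H F a" "p < a" "\<And>r. p \<le> r \<Longrightarrow> r < a \<Longrightarrow> H r < H a"
      and "p \<le> q" "min (H q) (F q) = H a"
    then show ?thesis
      using limited_flux_right[OF a] min[of q] p0 by simp
  next
    assume p: "relaxed_slope H F p"
    then have "H p \<le> l"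
      using cross unfolding relaxed_slope_def by (meson not_le order_trans)
    then show ?thesis
      using limited_flux_relaxed_slope[OF p] by simp
  qed
qed

lemma limited_flux_ge:
  assumes p0: "p \<le> p0" "l \<le> H p0" and max: "\<And>q. q \<le> p0 \<Longrightarrow> l \<le> max (H q) (F q)"
  shows "l \<le> G p"
proof -
  have cross: "\<exists>q\<ge>p. l \<le> min (H q) (F q)" if lt: "H p < l"
  proof -
    obtain q where q: "p < q" "q \<le> p0" "H q = l" "\<And>r. p \<le> r \<Longrightarrow> r < q \<Longrightarrow> H r < l"
      using first_hit[OF contH p0(1) lt p0(2)] by blast
    have "l \<le> F r" if "p < r" "r < q" for r
      using max[of r] q(2) q(4)[of r] that by auto
    then have "l \<le> F q" by (rule F_ge_if_ge_on_left[OF q(1)])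
    with q show ?thesis by (intro exI[of _ q]) auto
  qed
  show ?thesis
  proof (rule relaxed_slope_cases[of p])
    fix a q assume a: "relaxed_slope H F a" "a < p" "\<And>r. a < r \<Longrightarrow> r \<le> p \<Longrightarrow> H a < H r"
      and "q \<le> p" "max (H q) (F q) = H a"
    then show ?thesis
      using limited_flux_left[OF a] max[of q] p0 by simp
  next
    fix a q assume a: "relaxed_slope H F a" "p < a" "\<And>r. p \<le> r \<Longrightarrow> r < a \<Longrightarrow> H r < H a"
      and greatest: "\<And>r. p \<le> r \<Longrightarrow> min (H r) (F r) \<le> H a"
    show ?thesis
      using limited_flux_right[OF a] cross greatest a(3)[of p] a(2)
      by (cases "H p < l") (fastforce dest: order_trans)+
  next
    assume p: "relaxed_slope H F p"
    then have "l \<le> H p"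
      using cross unfolding relaxed_slope_def by (meson not_le order_trans)
    then show ?thesis
      using limited_flux_relaxed_slope[OF p] by simp
  qed
qed

section \<open>Uniqueness of the set limiter\<close>

text \<open>The two hypotheses on the limited flux are what the planar solutions of slope \<open>p \<in> A_F\<close> impose. If the
  interval of \<open>a \<in> A\<close> meets that of \<open>p\<close> at \<open>r\<close>, they compare \<open>H a\<close> with \<open>H p\<close> at \<open>r\<close> and, when \<open>p\<close> lies in
  the interval of \<open>a\<close>, at \<open>p\<close>. For \<open>a \<noteq> p\<close> the result contradicts the sign of \<open>H - H a\<close> or
  \<open>H - H p\<close> at \<open>r\<close>.\<close>
lemma set_limiter_eqI:
  assumes A: "set_limiter H A"
    and le: "\<And>p q. p \<in> A_F H F \<Longrightarrow> p \<le> q \<Longrightarrow> limited_flux H A q \<le> H p"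
    and ge: "\<And>p q. p \<in> A_F H F \<Longrightarrow> q \<le> p \<Longrightarrow> H p \<le> limited_flux H A q"
  shows "A = A_F H F"
proof -
  have flux: "limited_flux H A r = H a" if "a \<in> A" "pminus H a \<le> r" "ereal r \<le> pplus H a" for a r
    using limited_flux_eq[OF contH A] that by (auto simp: closed_ival_def)
  have A1: "\<And>a. a \<in> A \<Longrightarrow> ereal (pminus H a) \<noteq> pplus H a"
    and A2: "\<And>a b. a \<in> A \<Longrightarrow> b \<in> A \<Longrightarrow> a < b \<Longrightarrow> H b \<le> H a"
    and A3: "\<And>p. pminus H p < p \<Longrightarrow> \<exists>a\<in>A. left_ival H p \<inter> open_ival H a \<noteq> {}"
    and A4: "\<And>p. ereal p < pplus H p \<Longrightarrow> \<exists>a\<in>A. right_ival H p \<inter> open_ival H a \<noteq> {}"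
    using A unfolding set_limiter_def by blast+
  have nontriv: "pminus H p < p \<or> ereal p < pplus H p" if "ereal (pminus H p) \<noteq> pplus H p" for p
    using that pminus_le[of p] pplus_ge[of p H] by (cases "pplus H p") auto
  have sub: "A_F H F \<subseteq> A"
  proof
    fix p assume p: "p \<in> A_F H F"
    then consider "pminus H p < p" | "ereal p < pplus H p"
      using nontriv by (auto simp: A_F_eq)
    then show "p \<in> A"
    proof cases
      case 1
      with A3 obtain a r where a: "a \<in> A"
        and r: "pminus H p < r" "r < p" "pminus H a < r" "ereal r < pplus H a"
        by (force simp: left_ival_def open_ival_def)
      have Hr: "H r < H p" using below_left r by blast
      have Ha: "H p \<le> H a" using ge[OF p, of r] flux[OF a, of r] r by simp
      have "a = p"
      proof (cases a p rule: linorder_cases)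
        case less
        then have "a < r" using pminus_ge[of a p H] Ha r by simp
        then show ?thesis using above_right[of a r H] r Hr Ha by simp
      next
        case greater
        then have "ereal p \<le> pplus H a"
          using pplus_ge[of a H] by (meson ereal_less_eq(3) less_imp_le order_trans)
        then have "H a \<le> H p"
          using le[OF p, of p] flux[OF a, of p] r by simp
        then show ?thesis using pminus_ge[OF greater, of H] r by simp
      qed
      with a show ?thesis by simp
    next
      case 2
      with A4 obtain a r where a: "a \<in> A"
        and r: "p < r" "ereal r < pplus H p" "pminus H a < r" "ereal r < pplus H a"
        by (force simp: right_ival_def open_ival_def)
      have Hr: "H p < H r" using above_right r by blast
      have Ha: "H a \<le> H p" using le[OF p, of r] flux[OF a, of r] r by simp
      have "a = p"
      proof (cases a p rule: linorder_cases)
        case greater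
        then have "ereal r < ereal a" using pplus_le[of p a H] Ha r by (meson order_less_le_trans)
        then have "r < a" by simp
        then show ?thesis using below_left[of r a H] r Hr Ha by simp
      next
        case less
        have "ereal p < ereal r" using r by simp
        then have "ereal p \<le> pplus H a" using r(4) by (meson less_imp_le order_less_trans)
        then have "H p \<le> H a"
          using ge[OF p, of p] flux[OF a, of p] pminus_le[of a] less by simp
        then have "pplus H a \<le> ereal p" using pplus_le[OF less, of H] by simp
        then show ?thesis using r(1,4) \<open>ereal p < ereal r\<close> by (meson order_less_asym order_less_le_trans)
      qed
      with a show ?thesis by simp
    qed
  qed
  have disjoint: "False" if ab: "a \<in> A" "b \<in> A" "a < b" and r: "r \<in> open_ival H a" "r \<in> open_ival H b"
    for a b r
  proof -
    have Hab: "H b \<le> H a" using A2 ab by blast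
    have "a < r" using pminus_ge[OF ab(3) Hab] r by (auto simp: open_ival_def)
    moreover have "ereal r < ereal b"
      using pplus_le[OF ab(3) Hab] r by (auto simp: open_ival_def dest: order_less_le_trans)
    ultimately show False
      using above_right[of a r H] below_left[of r b H] Hab r by (auto simp: open_ival_def)
  qed
  have "a \<in> A_F H F" if a: "a \<in> A" for a
  proof -
    have "left_ival H a \<union> right_ival H a \<subseteq> open_ival H a"
    proof -
      have "ereal r < pplus H a" if "r < a" for r
        using pplus_ge[of a H] that by (meson less_ereal.simps(1) order_less_le_trans)
      then show ?thesis
        using pminus_le[of a] by (auto simp: open_ival_def left_ival_def right_ival_def)
    qed
    moreover have "\<exists>b\<in>A_F H F. (left_ival H a \<union> right_ival H a) \<inter> open_ival H b \<noteq> {}"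
      using nontriv[OF A1[OF a]] set_limiter_A_F unfolding set_limiter_def by blast
    ultimately obtain b r where b: "b \<in> A_F H F" "r \<in> open_ival H a" "r \<in> open_ival H b"
      by blast
    then have "a = b"
      using disjoint[of a b r] disjoint[of b a r] a sub by (meson linorder_neqE subsetD)
    with b show ?thesis by simp
  qed
  with sub show ?thesis by blast
qed

end

section \<open>Upper semicontinuous functions and test functions\<close>

text \<open>Real-valued upper semicontinuity relative to \<open>S\<close>. Finite upper envelopes have this property, and together with
  the interior inequality it is all that the critical slope argument asks of a subsolution.\<close>
definition usc_on :: "'a::topological_space set \<Rightarrow> ('a \<Rightarrow> real) \<Rightarrow> bool" where
  "usc_on S w \<longleftrightarrow> (\<forall>z\<in>S. \<forall>c>w z. \<forall>\<^sub>F y in at z within S. w y < c)"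

lemma usc_on_subset: "usc_on S w \<Longrightarrow> K \<subseteq> S \<Longrightarrow> usc_on K w"
  unfolding usc_on_def by (meson at_le filter_leD subsetD)

lemma usc_on_diff_continuous:
  assumes "usc_on S w" "continuous_on S g"
  shows "usc_on S (\<lambda>z. w z - g z)"
  unfolding usc_on_def
proof (intro ballI allI impI)
  fix z c assume z: "z \<in> S" and c: "w z - g z < c"
  define e where "e = (c - (w z - g z)) / 2"
  have e: "e > 0" using c by (simp add: e_def)
  have "\<forall>\<^sub>F y in at z within S. w y < w z + e"
    using assms(1) z e by (simp add: usc_on_def)
  moreover have "\<forall>\<^sub>F y in at z within S. g z - e < g y"
    using assms(2) z e by (auto simp: continuous_on_def dest!: order_tendstoD(1)[of _ _ _ "g z - e"])
  ultimately show "\<forall>\<^sub>F y in at z within S. w y - g y < c"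
  proof eventually_elim
    case (elim y)
    moreover have "2 * e = c - (w z - g z)" by (simp add: e_def)
    ultimately show ?case by linarith
  qed
qed

text \<open>If no point were a maximum, each point would have a neighbourhood on which \<open>w\<close> stays below
  one fixed value \<open>w (f z)\<close>. The largest of the finitely many values needed to cover \<open>K\<close> would then exceed itself.\<close>
lemma usc_attains_max:
  assumes "compact K" "K \<noteq> {}" "usc_on K w"
  obtains z where "z \<in> K" "\<And>y. y \<in> K \<Longrightarrow> w y \<le> w z"
proof (rule ccontr)
  assume "\<not> thesis"
  then have "\<forall>z\<in>K. \<exists>z'\<in>K. w z < w z'"
    using that by (meson not_le)
  then obtain f where f: "\<And>z. z \<in> K \<Longrightarrow> f z \<in> K \<and> w z < w (f z)" by metis
  have "\<exists>V. open V \<and> z \<in> V \<and> (\<forall>y\<in>V \<inter> K. w y < w (f z))" if "z \<in> K" for z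
  proof -
    have "\<forall>\<^sub>F y in at z within K. w y < w (f z)"
      using assms(3) f[OF that] that by (simp add: usc_on_def)
    then obtain V where "open V" "z \<in> V" "\<forall>y\<in>V. y \<noteq> z \<longrightarrow> y \<in> K \<longrightarrow> w y < w (f z)"
      by (auto simp: eventually_at_topological)
    then show ?thesis using f[OF that] by (intro exI[of _ V]) auto
  qed
  then obtain V where V: "\<And>z. z \<in> K \<Longrightarrow> open (V z) \<and> z \<in> V z \<and> (\<forall>y\<in>V z \<inter> K. w y < w (f z))"
    by metis
  obtain C where C: "C \<subseteq> K" "finite C" "K \<subseteq> (\<Union>z\<in>C. V z)"
    by (rule compactE_image[OF assms(1), of K V]) (use V in auto)
  then have "C \<noteq> {}" using assms(2) by auto
  then obtain z0 where z0: "z0 \<in> C" "\<And>z. z \<in> C \<Longrightarrow> w (f z) \<le> w (f z0)"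
    using ex_is_arg_min_if_finite[OF C(2), of "\<lambda>z. - w (f z)"] by (auto simp: is_arg_min_linorder)
  have "f z0 \<in> K" using f z0(1) C(1) by auto
  then obtain z where "z \<in> C" "f z0 \<in> V z" using C(3) by auto
  then have "w (f z0) < w (f z)" using V[of z] C(1) \<open>f z0 \<in> K\<close> by auto
  with z0(2)[OF \<open>z \<in> C\<close>] show False by simp
qed

lemma test_function_add:
  assumes "test_function T f ft fx" "test_function T g gt gx"
  shows "test_function T (\<lambda>z. f z + g z) (\<lambda>z. ft z + gt z) (\<lambda>z. fx z + gx z)"
  using assms unfolding test_function_def
  by (auto intro!: continuous_intros derivative_eq_intros simp: fun_eq_iff algebra_simps)

lemma test_function_uminus:
  assumes "test_function T f ft fx"
  shows "test_function T (\<lambda>z. - f z) (\<lambda>z. - ft z) (\<lambda>z. - fx z)"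
  using assms unfolding test_function_def
  by (auto intro!: continuous_intros derivative_eq_intros simp: fun_eq_iff algebra_simps)

lemma test_function_separable:
  assumes f: "\<And>s. (f has_real_derivative f' s) (at s)" "continuous_on UNIV f'"
    and g: "\<And>s. (g has_real_derivative g' s) (at s)" "continuous_on UNIV g'"
  shows "test_function T (\<lambda>z. f (fst z) + g (snd z)) (\<lambda>z. f' (fst z)) (\<lambda>z. g' (snd z))"
  unfolding test_function_def
proof (intro conjI ballI)
  fix z assume "z \<in> dom T"
  have "((\<lambda>z. f (fst z)) has_derivative (\<lambda>h. f' (fst z) * fst h)) (at z within dom T)"
    "((\<lambda>z. g (snd z)) has_derivative (\<lambda>h. g' (snd z) * snd h)) (at z within dom T)"
    using f(1)[of "fst z"] g(1)[of "snd z"] unfolding has_field_derivative_def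
    by (auto intro: has_derivative_compose[OF has_derivative_fst[OF has_derivative_ident]]
        has_derivative_compose[OF has_derivative_snd[OF has_derivative_ident]])
  then show "((\<lambda>z. f (fst z) + g (snd z)) has_derivative (\<lambda>(s, y). f' (fst z) * s + g' (snd z) * y)) (at z within dom T)"
    unfolding case_prod_unfold by (rule has_derivative_add)
next
  show "continuous_on (dom T) (\<lambda>z. f' (fst z))"
    by (rule continuous_on_compose2[OF f(2)]) (auto intro: continuous_on_fst continuous_on_id)
  show "continuous_on (dom T) (\<lambda>z. g' (snd z))"
    by (rule continuous_on_compose2[OF g(2)]) (auto intro: continuous_on_snd continuous_on_id)
qed

lemma test_function_continuous: "test_function T f ft fx \<Longrightarrow> continuous_on (dom T) f"
  unfolding test_function_def
  by (auto intro: has_derivative_continuous_on[where f' = "\<lambda>z (s, y). ft z * s + fx z * y"])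

text \<open>The squared ramp is the \<open>C\<^sup>1\<close> penalty of the critical slope argument: it vanishes identically on one side,
  so it does not spoil a strict inequality whose size is not controlled.\<close>
lemma has_real_derivative_ramp: "((\<lambda>s. (max 0 s)\<^sup>2) has_real_derivative 2 * max 0 s) (at s)" for s :: real
proof (cases s "0::real" rule: linorder_cases)
  case less
  have ev: "eventually (\<lambda>x. x < 0) (nhds s)"
    using eventually_nhds_in_open[of "{..<0}" s] less by simp
  have "((\<lambda>s. (max 0 s)\<^sup>2) has_real_derivative 0) (at s)"
    by (rule DERIV_cong_ev[THEN iffD2, OF refl _ refl, of _ "\<lambda>_. 0"])
      (use ev in \<open>auto elim!: eventually_mono\<close>)
  then show ?thesis using less by simp
next
  case greater
  have ev: "eventually (\<lambda>x. x > 0) (nhds s)"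
    using eventually_nhds_in_open[of "{0<..}" s] greater by simp
  have "((\<lambda>s. (max 0 s)\<^sup>2) has_real_derivative 2 * s) (at s)"
    by (rule DERIV_cong_ev[THEN iffD2, OF refl _ refl, of _ "\<lambda>s. s\<^sup>2"])
      (use ev in \<open>auto elim!: eventually_mono intro!: derivative_eq_intros\<close>)
  then show ?thesis using greater by simp
next
  case equal
  have "((\<lambda>h. (max 0 h)\<^sup>2 / h) \<longlongrightarrow> 0) (at (0::real))"
  proof (rule Lim_null_comparison)
    show "\<forall>\<^sub>F h in at 0. norm ((max 0 h)\<^sup>2 / h) \<le> \<bar>h\<bar>" for h :: real
      by (intro always_eventually) (auto simp: max_def power2_eq_square)
    show "((\<lambda>h. \<bar>h\<bar>) \<longlongrightarrow> 0) (at (0::real))"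
      by (intro tendsto_rabs_zero tendsto_ident_at)
  qed
  then show ?thesis using equal by (simp add: DERIV_def)
qed

lemma has_real_derivative_ramp_compose:
  fixes h :: "real \<Rightarrow> real"
  assumes "(h has_real_derivative h') (at s)"
  shows "((\<lambda>s. (max 0 (h s))\<^sup>2) has_real_derivative 2 * max 0 (h s) * h') (at s)"
  using DERIV_chain2[OF has_real_derivative_ramp assms] .

section \<open>Critical slopes\<close>

definition interior_subsolution ::
  "real \<Rightarrow> (real \<Rightarrow> real) \<Rightarrow> (real \<times> real \<Rightarrow> real) \<Rightarrow> bool" where
  "interior_subsolution T H w \<longleftrightarrow>
     (\<forall>\<phi> \<phi>t \<phi>x t x. test_function T \<phi> \<phi>t \<phi>x \<and> (t, x) \<in> dom T \<and> x > 0 \<and>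
        (\<forall>\<^sub>F y in at (t, x) within dom T. w y - \<phi> y \<le> w (t, x) - \<phi> (t, x)) \<longrightarrow>
        \<phi>t (t, x) + H (\<phi>x (t, x)) \<le> 0)"

text \<open>The slope \<open>q\<close> is a tilt relative to \<open>\<phi>\<close>: the tilted test function has the boundary slope \<open>\<phi>\<^sub>x + q\<close>.\<close>
definition touching_slope ::
  "real \<Rightarrow> (real \<times> real \<Rightarrow> real) \<Rightarrow> (real \<times> real \<Rightarrow> real) \<Rightarrow> real \<Rightarrow> real \<Rightarrow> bool" where
  "touching_slope T w \<phi> t q \<longleftrightarrow>
     (\<forall>\<^sub>F z in at (t, 0) within dom T. w z - \<phi> z - q * snd z \<le> w (t, 0) - \<phi> (t, 0))"

lemma touching_slope_mono:
  assumes "touching_slope T w \<phi> t q" "q \<le> q'"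
  shows "touching_slope T w \<phi> t q'"
proof -
  have "\<forall>\<^sub>F z in at (t, 0) within dom T. z \<in> dom T"
    by (simp add: eventually_at_filter)
  with assms(1) show ?thesis
    unfolding touching_slope_def
  proof eventually_elim
    case (elim z)
    then have "q * snd z \<le> q' * snd z"
      using assms(2) by (auto simp: dom_def intro: mult_right_mono)
    with elim show ?case by linarith
  qed
qed

text \<open>The tilt \<open>q1\<close> fails, so \<open>w - \<phi> - q1 x\<close> exceeds its value \<open>m\<close> at the boundary point arbitrarily close to it.
  Subtract a penalty that vanishes on the half-size box and, on the outer sides of the box of size \<open>r\<close>, is at least
  \<open>(q2 - q1) r\<close>, the most by which the tilts \<open>q1\<close> and \<open>q2\<close> differ there. As \<open>q2\<close> keeps contact, the penalized function is at
  most \<open>m\<close> on these sides and on \<open>x = 0\<close>. So it has its maximum inside, where the equation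
  holds, and the penalty changes the derivatives by at most \<open>4 (q2 - q1)\<close>, however small \<open>r\<close> is.\<close>
lemma interior_point_between_slopes:
  assumes \<phi>: "test_function T \<phi> \<phi>t \<phi>x" and usc: "usc_on (dom T) w"
    and sub: "interior_subsolution T H w" and t0: "0 < t0" "t0 < T" and "q1 < q2"
    and q2: "touching_slope T w \<phi> t0 q2" and q1: "\<not> touching_slope T w \<phi> t0 q1"
    and d: "0 < d"
  obtains t x a b where "(t, x) \<in> dom T" "\<bar>t - t0\<bar> \<le> d" "x \<le> d" "\<bar>a\<bar> \<le> 4 * (q2 - q1)"
    "\<bar>b\<bar> \<le> 4 * (q2 - q1)" "\<phi>t (t, x) + a + H (\<phi>x (t, x) + q1 + b) \<le> 0"
proof -
  define m where "m = w (t0, 0) - \<phi> (t0, 0)"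
  define D where "D = q2 - q1"
  have D: "D > 0" using \<open>q1 < q2\<close> by (simp add: D_def)
  obtain \<delta> where \<delta>: "\<delta> > 0" and touch:
    "\<And>z. z \<in> dom T \<Longrightarrow> dist z (t0, 0) < \<delta> \<Longrightarrow> w z - \<phi> z - q2 * snd z \<le> m"
  proof -
    obtain \<delta> where "\<delta> > 0" "\<forall>z\<in>dom T. z \<noteq> (t0, 0) \<and> dist z (t0, 0) < \<delta> \<longrightarrow> w z - \<phi> z - q2 * snd z \<le> m"
      using q2 unfolding touching_slope_def eventually_at m_def by blast
    then show thesis using that[of \<delta>] by (metis diff_zero mult_zero_right order_refl snd_conv m_def)
  qed
  define r where "r = min (min d (\<delta> / 3)) (min (t0 / 2) ((T - t0) / 2))"
  have r: "r > 0" "r \<le> d" "3 * r \<le> \<delta>" "r < t0" "t0 + r < T"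
  proof -
    have "r \<le> t0 / 2" "r \<le> (T - t0) / 2" "r \<le> \<delta> / 3"
      unfolding r_def by linarith+
    then show "3 * r \<le> \<delta>" "r < t0" "t0 + r < T" using t0 by (auto simp: field_simps)
    show "r > 0" "r \<le> d" using d \<delta> t0 by (auto simp: r_def)
  qed
  define K where "K = {t0 - r..t0 + r} \<times> {0..r}"
  have K: "compact K" "K \<subseteq> dom T"
    using r by (auto simp: K_def dom_def intro: compact_Times)
  have near: "w z - \<phi> z - q2 * snd z \<le> m" if "z \<in> K" for z
  proof -
    have "dist z (t0, 0) \<le> \<bar>fst z - t0\<bar> + \<bar>snd z\<bar>"
      by (cases z) (simp add: dist_Pair_Pair dist_real_def sqrt_sum_squares_le_sum_abs)
    also have "\<dots> < \<delta>"
      using that r by (auto simp: K_def abs_le_iff)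
    finally show ?thesis using touch that K(2) by blast
  qed
  obtain z1 where z1: "z1 \<in> dom T" "dist z1 (t0, 0) < r / 2" "m < w z1 - \<phi> z1 - q1 * snd z1"
    using q1 r(1) unfolding touching_slope_def eventually_at m_def by (metis half_gt_zero not_le)
  have z1': "\<bar>fst z1 - t0\<bar> < r / 2" "\<bar>snd z1\<bar> < r / 2"
    using dist_fst_le[of z1 "(t0, 0)"] dist_snd_le[of z1 "(t0, 0)"] z1(2) by (auto simp: dist_real_def)
  \<comment> \<open>This factor makes the penalty \<open>c (r/2)\<^sup>2\<close> at distance \<open>r\<close> equal to \<open>D r\<close>; its slope is then at most \<open>c r = 4 D\<close>.\<close>
  define c where "c = 4 * D / r"
  define f where "f s = c * ((max 0 (s - t0 - r/2))\<^sup>2 + (max 0 (t0 - s - r/2))\<^sup>2)" for s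
  define f' where "f' s = c * (2 * max 0 (s - t0 - r/2) - 2 * max 0 (t0 - s - r/2))" for s
  define g where "g y = q1 * y + c * (max 0 (y - r/2))\<^sup>2" for y
  define g' where "g' y = q1 + c * (2 * max 0 (y - r/2))" for y
  have ramps: "((\<lambda>s. (max 0 (s - t0 - r/2))\<^sup>2) has_real_derivative 2 * max 0 (s - t0 - r/2) * 1) (at s)"
    "((\<lambda>s. (max 0 (t0 - s - r/2))\<^sup>2) has_real_derivative 2 * max 0 (t0 - s - r/2) * (- 1)) (at s)"
    "((\<lambda>s. (max 0 (s - r/2))\<^sup>2) has_real_derivative 2 * max 0 (s - r/2) * 1) (at s)" for s
    by (rule has_real_derivative_ramp_compose; auto intro!: derivative_eq_intros)+
  have "(f has_real_derivative f' s) (at s)" for s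
    unfolding f_def f'_def using DERIV_cmult[OF DERIV_add[OF ramps(1,2)], of c s] by simp
  moreover have "(g has_real_derivative g' s) (at s)" for s
    unfolding g_def g'_def
    using DERIV_add[OF DERIV_cmult[OF DERIV_ident] DERIV_cmult[OF ramps(3)], of q1 c s] by simp
  moreover have "continuous_on UNIV f'" "continuous_on UNIV g'"
    unfolding f'_def g'_def by (intro continuous_intros)+
  ultimately have "test_function T (\<lambda>z. f (fst z) + g (snd z)) (\<lambda>z. f' (fst z)) (\<lambda>z. g' (snd z))"
    by (intro test_function_separable)
  note \<psi> = test_function_add[OF \<phi> this]
  define W where "W z = w z - (\<phi> z + (f (fst z) + g (snd z)))" for z
  have "usc_on (dom T) W"
    unfolding W_def by (intro usc_on_diff_continuous usc test_function_continuous[OF \<psi>])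
  then have "usc_on K W" using K(2) by (rule usc_on_subset)
  have z1K: "z1 \<in> K"
  proof -
    have "t0 - r \<le> fst z1" "fst z1 \<le> t0 + r" "snd z1 \<le> r"
      using z1' r(1) by linarith+
    moreover have "0 \<le> snd z1" using z1(1) by (auto simp: dom_def)
    ultimately show ?thesis by (simp add: K_def mem_Times_iff)
  qed
  obtain zm where zm: "zm \<in> K" "\<And>y. y \<in> K \<Longrightarrow> W y \<le> W zm"
    using usc_attains_max[OF K(1) _ \<open>usc_on K W\<close>] z1K by blast
  obtain t x where tx: "zm = (t, x)" by (cases zm)
  have "fst z1 - t0 - r/2 \<le> 0" "t0 - fst z1 - r/2 \<le> 0" "snd z1 - r/2 \<le> 0"
    using z1' by linarith+
  then have "W z1 = w z1 - \<phi> z1 - q1 * snd z1"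
    by (simp add: W_def f_def g_def max_absorb1)
  then have Wm: "m < W (t, x)" using zm(2)[OF z1K] z1(3) tx by simp
  have c: "c > 0" using D r by (simp add: c_def)
  have fpos: "0 \<le> f s" for s using c by (simp add: f_def)
  have bound: "W (t, x) \<le> m + D * x - f t - c * (max 0 (x - r/2))\<^sup>2"
    using near[OF zm(1)] by (simp add: tx W_def g_def D_def algebra_simps)
  have tK: "\<bar>t - t0\<bar> \<le> r" "0 \<le> x" "x \<le> r" using zm(1) tx by (auto simp: K_def abs_le_iff)
  have crr: "c * (r/2)\<^sup>2 = D * r" using r by (simp add: c_def power2_eq_square)
  have Dx: "D * x \<le> D * r" using D tK by simp
  have x0: "x > 0"
  proof (rule ccontr)
    assume "\<not> x > 0"
    then have "x = 0" using tK by simp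
    then show False using bound Wm fpos[of t] c r by (simp add: max_def)
  qed
  have xr: "x < r"
  proof (rule ccontr)
    assume "\<not> x < r"
    then have "x = r" using tK by simp
    then have "max 0 (x - r/2) = r/2" using r by simp
    then have "c * (max 0 (x - r/2))\<^sup>2 = D * r" using crr by (simp only:)
    then show False using bound Wm fpos[of t] Dx by linarith
  qed
  have tr: "\<bar>t - t0\<bar> < r"
  proof (rule ccontr)
    assume "\<not> \<bar>t - t0\<bar> < r"
    then have "\<bar>t - t0\<bar> = r" using tK by simp
    then consider "t = t0 + r" | "t = t0 - r" by linarith
    then have "f t = c * (r/2)\<^sup>2" by cases (use r in \<open>simp_all add: f_def max_def\<close>)
    moreover have "0 \<le> c * (max 0 (x - r/2))\<^sup>2" using c by simp
    ultimately show False using bound Wm crr Dx by linarith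
  qed
  have "\<forall>\<^sub>F y in at (t, x) within dom T. W y \<le> W (t, x)"
  proof -
    have "open ({t0 - r<..<t0 + r} \<times> {..<r})" "(t, x) \<in> {t0 - r<..<t0 + r} \<times> {..<r}"
      using tr xr by (auto intro!: open_Times simp: abs_less_iff)
    moreover have "y \<in> K" if "y \<in> {t0 - r<..<t0 + r} \<times> {..<r}" "y \<in> dom T" for y
      using that by (auto simp: K_def dom_def)
    ultimately show ?thesis
      unfolding eventually_at_topological using zm(2) tx by blast
  qed
  then have "\<phi>t (t, x) + f' t + H (\<phi>x (t, x) + g' x) \<le> 0"
    using sub \<psi> x0 zm(1) K(2) unfolding interior_subsolution_def W_def tx by force
  then have eq: "\<phi>t (t, x) + f' t + H (\<phi>x (t, x) + q1 + c * (2 * max 0 (x - r/2))) \<le> 0"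
    by (simp add: g'_def add.assoc)
  have cr: "c * r = 4 * D" using r by (simp add: c_def)
  have slope: "\<bar>c * s\<bar> \<le> 4 * (q2 - q1)" if "\<bar>s\<bar> \<le> r" for s
    using mult_left_mono[OF that, of c] c cr by (simp add: abs_mult D_def)
  show thesis
  proof (rule that[OF _ _ _ _ _ eq])
    have half: "0 \<le> max 0 s" "max 0 s \<le> r/2" if "s \<le> r/2" for s
      using that r(1) by simp_all
    have "t - t0 - r/2 \<le> r/2" "t0 - t - r/2 \<le> r/2" "x - r/2 \<le> r/2"
      using tr xr by linarith+
    note halves = this[THEN half(1)] this[THEN half(2)]
    have close: "\<bar>2 * a' - 2 * b'\<bar> \<le> r" "\<bar>2 * a'\<bar> \<le> r"
      if "0 \<le> a'" "a' \<le> r/2" "0 \<le> b'" "b' \<le> r/2" for a' b'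
      using that by linarith+
    show "\<bar>f' t\<bar> \<le> 4 * (q2 - q1)" unfolding f'_def
      by (intro slope close halves)
    show "\<bar>c * (2 * max 0 (x - r/2))\<bar> \<le> 4 * (q2 - q1)"
      by (rule slope) (rule close(2)[OF halves(3,6,3,6)])
  qed (use zm(1) K(2) tx tr xr r in auto)
qed

text \<open>The critical slope \<open>p0\<close> is the infimum of the tilts that keep contact. Applying the previous lemma
  to tilts \<open>p0 \<plusminus> \<epsilon>\<close> on boxes of size \<open>\<epsilon>\<close> yields interior inequalities that converge to the claim as
  \<open>\<epsilon> \<rightarrow> 0\<close>. The hypothesis on \<open>q0\<close> says that the infimum is finite.\<close>
lemma critical_slope:
  assumes \<phi>: "test_function T \<phi> \<phi>t \<phi>x" and usc: "usc_on (dom T) w" and H: "continuous_on UNIV H"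
    and sub: "interior_subsolution T H w" and t0: "0 < t0" "t0 < T"
    and zero: "touching_slope T w \<phi> t0 0" and proper: "\<not> touching_slope T w \<phi> t0 q0"
  obtains p0 where "p0 \<le> 0" "\<And>q. p0 < q \<Longrightarrow> touching_slope T w \<phi> t0 q"
    "\<phi>t (t0, 0) + H (\<phi>x (t0, 0) + p0) \<le> 0"
proof -
  define S where "S = {q. touching_slope T w \<phi> t0 q}"
  have bdd: "bdd_below S"
    by (rule bdd_belowI[of _ q0]) (metis S_def linear mem_Collect_eq proper touching_slope_mono)
  define p0 where "p0 = Inf S"
  have ne: "S \<noteq> {}" using zero by (auto simp: S_def)
  have le: "p0 \<le> 0" unfolding p0_def using bdd zero by (intro cInf_lower) (auto simp: S_def)
  have above: "touching_slope T w \<phi> t0 q" if "p0 < q" for q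
  proof -
    obtain q' where "q' \<in> S" "q' < q" using \<open>p0 < q\<close> cInf_less_iff[OF ne bdd, of q] unfolding p0_def by blast
    then show ?thesis using touching_slope_mono[of T w \<phi> t0 q' q] by (auto simp: S_def)
  qed
  have below: "\<not> touching_slope T w \<phi> t0 q" if "q < p0" for q
    using cInf_lower[OF _ bdd, of q] that by (auto simp: S_def p0_def)
  define e where "e n = inverse (real (Suc n))" for n
  have e: "e n > 0" for n by (simp add: e_def)
  have e0: "e \<longlonglongrightarrow> 0" unfolding e_def by (rule LIMSEQ_inverse_real_of_nat)
  have "\<exists>t x a b. (t, x) \<in> dom T \<and> \<bar>t - t0\<bar> \<le> e n \<and> x \<le> e n \<and> \<bar>a\<bar> \<le> 8 * e n \<and> \<bar>b\<bar> \<le> 8 * e n \<and>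
      \<phi>t (t, x) + a + H (\<phi>x (t, x) + (p0 - e n) + b) \<le> 0" for n
  proof -
    have "p0 - e n < p0 + e n" "p0 < p0 + e n" "p0 - e n < p0" using e[of n] by auto
    from interior_point_between_slopes[OF \<phi> usc sub t0 this(1) above[OF this(2)] below[OF this(3)] e[of n]]
    obtain t x a b where "(t, x) \<in> dom T" "\<bar>t - t0\<bar> \<le> e n" "x \<le> e n"
      "\<bar>a\<bar> \<le> 4 * (p0 + e n - (p0 - e n))" "\<bar>b\<bar> \<le> 4 * (p0 + e n - (p0 - e n))"
      "\<phi>t (t, x) + a + H (\<phi>x (t, x) + (p0 - e n) + b) \<le> 0" by blast
    then show ?thesis by (intro exI[of _ t] exI[of _ x] exI[of _ a] exI[of _ b]) simp
  qed
  then obtain t x a b where tx: "\<And>n. (t n, x n) \<in> dom T" "\<And>n. \<bar>t n - t0\<bar> \<le> e n" "\<And>n. x n \<le> e n"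
    and ab: "\<And>n. \<bar>a n\<bar> \<le> 8 * e n" "\<And>n. \<bar>b n\<bar> \<le> 8 * e n"
    and ineq: "\<And>n. \<phi>t (t n, x n) + a n + H (\<phi>x (t n, x n) + (p0 - e n) + b n) \<le> 0"
    by metis
  have e8: "(\<lambda>n. 8 * e n) \<longlonglongrightarrow> 0" using tendsto_mult_right_zero[OF e0] by simp
  have a0: "a \<longlonglongrightarrow> 0" and b0: "b \<longlonglongrightarrow> 0"
    using ab by (auto intro!: Lim_null_comparison[OF _ e8])
  have "(\<lambda>n. t n - t0) \<longlonglongrightarrow> 0"
    using tx(2) by (auto intro!: Lim_null_comparison[OF _ e0])
  then have "t \<longlonglongrightarrow> t0" by (simp add: LIM_zero_iff)
  moreover have "x \<longlonglongrightarrow> 0"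
    using tx(1,3) by (auto intro!: Lim_null_comparison[OF _ e0] simp: dom_def)
  ultimately have lim: "(\<lambda>n. (t n, x n)) \<longlonglongrightarrow> (t0, 0)" by (rule tendsto_Pair)
  have mem: "(t0, 0) \<in> dom T" using t0 by (simp add: dom_def)
  have "(\<lambda>n. \<phi>t (t n, x n)) \<longlonglongrightarrow> \<phi>t (t0, 0)" "(\<lambda>n. \<phi>x (t n, x n)) \<longlonglongrightarrow> \<phi>x (t0, 0)"
    using \<phi> tx(1) lim mem unfolding test_function_def
    by (auto intro!: continuous_on_tendsto_compose[of "dom T"])
  then have "(\<lambda>n. \<phi>t (t n, x n) + a n + H (\<phi>x (t n, x n) + (p0 - e n) + b n))
      \<longlonglongrightarrow> \<phi>t (t0, 0) + 0 + H (\<phi>x (t0, 0) + (p0 - 0) + 0)"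
    by (intro tendsto_intros a0 b0 e0 continuous_on_tendsto_compose[OF H]) auto
  then have "\<phi>t (t0, 0) + H (\<phi>x (t0, 0) + p0) \<le> 0"
    using LIMSEQ_le_const2 ineq by (metis (no_types, lifting) add.right_neutral diff_zero)
  with le above show thesis by (rule that)
qed

section \<open>Semicontinuous envelopes and reflection\<close>

lemma dom_subset_dom0: "dom T \<subseteq> dom0 T"
  by (auto simp: dom_def dom0_def)

text \<open>Without this, the upper limits below would be \<open>- \<infinity>\<close> by convention.\<close>
lemma dom0_filter_nontrivial:
  assumes "z \<in> dom0 T" shows "inf (nhds z) (principal (dom0 T)) \<noteq> bot"
proof
  assume "inf (nhds z) (principal (dom0 T)) = bot"
  then have "eventually (\<lambda>_. False) (inf (nhds z) (principal (dom0 T)))"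
    by simp
  then have "\<forall>\<^sub>F y in nhds z. y \<in> dom0 T \<longrightarrow> False"
    unfolding eventually_inf_principal .
  then show False using assms eventually_nhds_x_imp_x by blast
qed

lemma upper_env_finite:
  assumes "locally_bounded T u" "z \<in> dom0 T"
  shows "\<bar>upper_env T u z\<bar> \<noteq> \<infinity>"
proof -
  obtain U where U: "open U" "z \<in> U" "bounded (u ` (U \<inter> dom0 T))"
    using assms by (auto simp: locally_bounded_def)
  then obtain B where B: "\<And>y. y \<in> U \<Longrightarrow> y \<in> dom0 T \<Longrightarrow> \<bar>u y\<bar> \<le> B"
    by (auto simp: bounded_iff)
  have ev: "\<forall>\<^sub>F y in inf (nhds z) (principal (dom0 T)). \<bar>u y\<bar> \<le> B"
    unfolding eventually_inf_principal using eventually_nhds_in_open[OF U(1,2)]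
    by eventually_elim (use B in auto)
  have "upper_env T u z \<le> ereal B" unfolding upper_env_def
    by (rule Limsup_bounded) (use ev in \<open>auto elim!: eventually_mono\<close>)
  moreover have "ereal (- B) \<le> upper_env T u z" unfolding upper_env_def
    by (rule le_Limsup[OF dom0_filter_nontrivial[OF assms(2)]]) (use ev in \<open>auto elim!: eventually_mono\<close>)
  ultimately show ?thesis by (cases "upper_env T u z") auto
qed

lemma upper_env_usc:
  assumes "upper_env T u z < c"
  shows "\<forall>\<^sub>F y in nhds z. upper_env T u y < c"
proof -
  obtain c' where c': "upper_env T u z < c'" "c' < c" using assms dense by blast
  then have "\<forall>\<^sub>F y in nhds z. y \<in> dom0 T \<longrightarrow> ereal (u y) < c'"
    using Limsup_lessD unfolding upper_env_def eventually_inf_principal[symmetric] by blast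
  then obtain V where V: "open V" "z \<in> V" "\<And>y. y \<in> V \<Longrightarrow> y \<in> dom0 T \<Longrightarrow> ereal (u y) < c'"
    unfolding eventually_nhds by blast
  have "upper_env T u y < c" if "y \<in> V" for y
  proof -
    have "\<forall>\<^sub>F x in nhds y. x \<in> V" using V(1) that by (rule eventually_nhds_in_open)
    then have "\<forall>\<^sub>F x in nhds y. x \<in> dom0 T \<longrightarrow> ereal (u x) \<le> c'"
      by eventually_elim (use V(3) in \<open>auto intro: less_imp_le\<close>)
    then have "upper_env T u y \<le> c'" unfolding upper_env_def
      by (intro Limsup_bounded) (simp add: eventually_inf_principal)
    then show ?thesis using c' by simp
  qed
  then show ?thesis using V unfolding eventually_nhds by blast
qed

lemma upper_env_continuous:
  assumes "continuous_on UNIV u" "z \<in> dom0 T"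
  shows "upper_env T u z = ereal (u z)"
  unfolding upper_env_def
proof (rule lim_imp_Limsup)
  have "isCont u z" using assms(1) continuous_on_eq_continuous_at[OF open_UNIV] by blast
  then have "(u \<longlongrightarrow> u z) (nhds z)"
    by (simp add: continuous_within tendsto_nhds_iff)
  then show "((\<lambda>w. ereal (u w)) \<longlongrightarrow> ereal (u z)) (inf (nhds z) (principal (dom0 T)))"
    by (intro tendsto_ereal) (rule tendsto_mono[OF inf_le1])
qed (use dom0_filter_nontrivial[OF assms(2)] in simp)

lemma upper_env_uminus: "upper_env T (\<lambda>z. - u z) = (\<lambda>z. - lower_env T u z)"
  unfolding upper_env_def lower_env_def using ereal_Limsup_uminus[of _ "\<lambda>w. ereal (u w)"] by simp

lemma locally_bounded_uminus: "locally_bounded T u \<Longrightarrow> locally_bounded T (\<lambda>z. - u z)"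
  unfolding locally_bounded_def by (auto simp: bounded_iff) 

lemma locally_bounded_continuous:
  assumes "continuous_on UNIV u" shows "locally_bounded T u"
  unfolding locally_bounded_def
proof
  fix z
  have "compact (u ` cball z 1)"
    by (intro compact_continuous_image continuous_on_subset[OF assms]) auto
  then have "bounded (u ` cball z 1)" by (rule compact_imp_bounded)
  then have "bounded (u ` (ball z 1 \<inter> dom0 T))"
    by (rule bounded_subset) auto
  then show "\<exists>U. open U \<and> z \<in> U \<and> bounded (u ` (U \<inter> dom0 T))"
    by (intro exI[of _ "ball z 1"]) auto
qed

lemma touches_above_cong:
  assumes "\<And>y. y \<in> dom T \<Longrightarrow> v y = ereal (w y)" "z \<in> dom T"
  shows "touches_above T \<phi> v z \<longleftrightarrow> (\<forall>\<^sub>F y in at z within dom T. w y - \<phi> y \<le> w z - \<phi> z)"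
proof -
  have "v y - ereal (\<phi> y) \<le> v z - ereal (\<phi> z) \<longleftrightarrow> w y - \<phi> y \<le> w z - \<phi> z" if "y \<in> dom T" for y
    using assms(1)[OF that] assms(1)[OF assms(2)] by simp
  then show ?thesis
    unfolding touches_above_def eventually_at_filter
    by (intro eventually_subst always_eventually) auto
qed

lemma touches_below_iff_above:
  "touches_below T \<phi> v z \<longleftrightarrow> touches_above T (\<lambda>y. - \<phi> y) (\<lambda>y. - v y) z"
proof -
  have "a - ereal b \<ge> c - ereal d \<longleftrightarrow> - a - ereal (- b) \<le> - c - ereal (- d)" for a c b d
    by (cases a; cases c) auto
  then show ?thesis unfolding touches_below_def touches_above_def by simp
qed

text \<open>The Hamiltonian of the equation for \<open>-u\<close>, up to the exchange of sub- and supersolutions.\<close>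
definition reflect :: "(real \<Rightarrow> real) \<Rightarrow> real \<Rightarrow> real" where
  "reflect H p = - H (- p)"

lemma relaxed_supersolution_iff:
  "relaxed_supersolution T H F u \<longleftrightarrow>
     relaxed_subsolution T (reflect H) (reflect F) (\<lambda>z. - u z)" (is "?L \<longleftrightarrow> ?R")
proof
  assume L: ?L
  show ?R unfolding relaxed_subsolution_def
  proof (intro allI impI)
    fix \<phi> \<phi>t \<phi>x :: "real \<times> real \<Rightarrow> real" and t x
    assume A: "test_function T \<phi> \<phi>t \<phi>x \<and> (t, x) \<in> dom T \<and> touches_above T \<phi> (upper_env T (\<lambda>z. - u z)) (t, x)"
    then have "test_function T (\<lambda>z. - \<phi> z) (\<lambda>z. - \<phi>t z) (\<lambda>z. - \<phi>x z)"
      using test_function_uminus by blast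
    moreover have "touches_below T (\<lambda>z. - \<phi> z) (lower_env T u) (t, x)"
      using A by (simp add: touches_below_iff_above upper_env_uminus)
    ultimately show "(x > 0 \<longrightarrow> \<phi>t (t, x) + reflect H (\<phi>x (t, x)) \<le> 0) \<and>
        (x = 0 \<longrightarrow> \<phi>t (t, 0) + reflect H (\<phi>x (t, 0)) \<le> 0 \<or> \<phi>t (t, 0) + reflect F (\<phi>x (t, 0)) \<le> 0)"
      using L[unfolded relaxed_supersolution_def, rule_format,
          of "\<lambda>z. - \<phi> z" "\<lambda>z. - \<phi>t z" "\<lambda>z. - \<phi>x z" t x] A by (auto simp: reflect_def)
  qed
next
  assume R: ?R
  show ?L unfolding relaxed_supersolution_def
  proof (intro allI impI)
    fix \<phi> \<phi>t \<phi>x :: "real \<times> real \<Rightarrow> real" and t x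
    assume A: "test_function T \<phi> \<phi>t \<phi>x \<and> (t, x) \<in> dom T \<and> touches_below T \<phi> (lower_env T u) (t, x)"
    then have "test_function T (\<lambda>z. - \<phi> z) (\<lambda>z. - \<phi>t z) (\<lambda>z. - \<phi>x z)"
      using test_function_uminus by blast
    moreover have "touches_above T (\<lambda>z. - \<phi> z) (upper_env T (\<lambda>z. - u z)) (t, x)"
      using A by (simp add: touches_below_iff_above upper_env_uminus)
    ultimately show "(x > 0 \<longrightarrow> \<phi>t (t, x) + H (\<phi>x (t, x)) \<ge> 0) \<and>
        (x = 0 \<longrightarrow> \<phi>t (t, 0) + H (\<phi>x (t, 0)) \<ge> 0 \<or> \<phi>t (t, 0) + F (\<phi>x (t, 0)) \<ge> 0)"
      using R[unfolded relaxed_subsolution_def, rule_format,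
          of "\<lambda>z. - \<phi> z" "\<lambda>z. - \<phi>t z" "\<lambda>z. - \<phi>x z" t x] A by (auto simp: reflect_def)
  qed
qed

section \<open>The critical slope of a relaxed subsolution\<close>

text \<open>All that the boundary point reveals about a relaxed subsolution: \<open>p0\<close> is the critical slope, and each larger slope belongs
  to a test function touching at the boundary. At \<open>p0\<close> itself the bound on \<open>H\<close> suffices. The first
  case is that of critical slope minus infinity.\<close>
lemma relaxed_subsolution_critical_slope:
  assumes u: "locally_bounded T u" "relaxed_subsolution T H F u" and H: "continuous_on UNIV H"
    and \<phi>: "test_function T \<phi> \<phi>t \<phi>x" and t: "(t, 0) \<in> dom T"
    and touch: "touches_above T \<phi> (upper_env T u) (t, 0)"
  obtains "\<And>q. min (H q) (F q) \<le> - \<phi>t (t, 0)"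
  | p0 where "p0 \<le> \<phi>x (t, 0)" "H p0 \<le> - \<phi>t (t, 0)" "\<And>q. p0 \<le> q \<Longrightarrow> min (H q) (F q) \<le> - \<phi>t (t, 0)"
proof -
  define w where "w z = real_of_ereal (upper_env T u z)" for z
  have w: "upper_env T u z = ereal (w z)" if "z \<in> dom T" for z
    using upper_env_finite[OF u(1), of z] that dom_subset_dom0[of T] by (auto simp: w_def ereal_real)
  have touch_iff: "touches_above T \<psi> (upper_env T u) z \<longleftrightarrow>
      (\<forall>\<^sub>F y in at z within dom T. w y - \<psi> y \<le> w z - \<psi> z)" if "z \<in> dom T" for \<psi> z
    using touches_above_cong[where w = w, OF w that] .
  have usc: "usc_on (dom T) w"
    unfolding usc_on_def
  proof (intro ballI allI impI)
    fix z c assume z: "z \<in> dom T" "w z < c"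
    then have "\<forall>\<^sub>F y in nhds z. upper_env T u y < ereal c"
      by (intro upper_env_usc) (simp add: w)
    then show "\<forall>\<^sub>F y in at z within dom T. w y < c"
      unfolding eventually_at_filter by eventually_elim (metis less_ereal.simps(1) w)
  qed
  have sub: "interior_subsolution T H w"
    unfolding interior_subsolution_def
  proof (intro allI impI, elim conjE)
    fix \<psi> \<psi>t \<psi>x :: "real \<times> real \<Rightarrow> real" and s x
    assume \<psi>: "test_function T \<psi> \<psi>t \<psi>x" "(s, x) \<in> dom T" "x > 0"
      and "\<forall>\<^sub>F y in at (s, x) within dom T. w y - \<psi> y \<le> w (s, x) - \<psi> (s, x)"
    then have "touches_above T \<psi> (upper_env T u) (s, x)"
      using touch_iff by simp
    then show "\<psi>t (s, x) + H (\<psi>x (s, x)) \<le> 0"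
      using u(2) \<psi> unfolding relaxed_subsolution_def by blast
  qed
  have zero: "touching_slope T w \<phi> t 0"
    using touch touch_iff[OF t] by (auto simp: touching_slope_def)
  have slope: "min (H (\<phi>x (t, 0) + q)) (F (\<phi>x (t, 0) + q)) \<le> - \<phi>t (t, 0)"
    if q: "touching_slope T w \<phi> t q" for q
  proof -
    have "test_function T (\<lambda>z. (\<lambda>_. 0) (fst z) + (\<lambda>y. q * y) (snd z)) (\<lambda>z. (\<lambda>_. 0) (fst z)) (\<lambda>z. (\<lambda>_. q) (snd z))"
      by (rule test_function_separable) (auto intro!: derivative_eq_intros)
    from test_function_add[OF \<phi> this]
    have "test_function T (\<lambda>z. \<phi> z + q * snd z) \<phi>t (\<lambda>z. \<phi>x z + q)" by simp
    moreover have "touches_above T (\<lambda>z. \<phi> z + q * snd z) (upper_env T u) (t, 0)"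
      using q touch_iff[OF t] by (simp add: touching_slope_def diff_diff_eq)
    ultimately show ?thesis
      using u(2) t unfolding relaxed_subsolution_def by (fastforce simp: min_le_iff_disj)
  qed
  show thesis
  proof (cases "\<exists>q. \<not> touching_slope T w \<phi> t q")
    case False
    then show ?thesis using that(1) slope by (metis add_diff_cancel_left' add.commute diff_add_cancel)
  next
    case True
    then obtain q0 where "\<not> touching_slope T w \<phi> t q0" ..
    moreover have "0 < t" "t < T" using t by (auto simp: dom_def)
    ultimately obtain p0 where p0: "p0 \<le> 0" "\<And>q. p0 < q \<Longrightarrow> touching_slope T w \<phi> t q"
      "\<phi>t (t, 0) + H (\<phi>x (t, 0) + p0) \<le> 0"
      using critical_slope[OF \<phi> usc H sub _ _ zero] by metis
    have "min (H q) (F q) \<le> - \<phi>t (t, 0)" if "\<phi>x (t, 0) + p0 \<le> q" for q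
    proof (cases "q = \<phi>x (t, 0) + p0")
      case False
      then show ?thesis using slope[OF p0(2), of "q - \<phi>x (t, 0)"] that by simp
    qed (use p0 in auto)
    with that(2)[of "\<phi>x (t, 0) + p0"] p0 show ?thesis by auto
  qed
qed

section \<open>Planar solutions\<close>

definition planar :: "real \<Rightarrow> real \<Rightarrow> real \<times> real \<Rightarrow> real" where
  "planar p l z = p * snd z - l * fst z"

lemma continuous_planar: "continuous_on S (planar p l)"
  unfolding planar_def by (intro continuous_intros)

lemma test_function_planar: "test_function T (planar p l) (\<lambda>_. - l) (\<lambda>_. p)"
proof -
  have "test_function T (\<lambda>z. (\<lambda>s. - l * s) (fst z) + (\<lambda>y. p * y) (snd z)) (\<lambda>z. (\<lambda>_. - l) (fst z)) (\<lambda>z. (\<lambda>_. p) (snd z))"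
    by (rule test_function_separable) (auto intro!: derivative_eq_intros)
  then show ?thesis by (simp add: planar_def[abs_def] algebra_simps)
qed

text \<open>One-sided Fermat condition: at a boundary point only the directions that enter the domain are available.\<close>
lemma local_max_derivative_nonpos:
  fixes f :: "'a::real_normed_vector \<Rightarrow> real"
  assumes f: "(f has_derivative f') (at z within S)"
    and max: "\<forall>\<^sub>F y in at z within S. f y \<le> f z"
    and d: "d > 0" and v: "\<And>h. 0 < h \<Longrightarrow> h < d \<Longrightarrow> z + h *\<^sub>R v \<in> S"
  shows "f' v \<le> 0"
proof (rule ccontr)
  assume pos: "\<not> f' v \<le> 0"
  define g where "g h = f (z + h *\<^sub>R v)" for h
  have "(\<lambda>h. z + h *\<^sub>R v) ` {0<..<d} \<subseteq> S"
    using v by auto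
  then have "(f has_derivative f') (at (z + 0 *\<^sub>R v) within (\<lambda>h. z + h *\<^sub>R v) ` {0<..<d})"
    using has_derivative_subset[OF f] by simp
  moreover have "((\<lambda>h. z + h *\<^sub>R v) has_derivative (\<lambda>h. h *\<^sub>R v)) (at 0 within {0<..<d})"
    by (auto intro!: derivative_eq_intros)
  ultimately have "(g has_derivative (\<lambda>h. f' (h *\<^sub>R v))) (at 0 within {0<..<d})"
    unfolding g_def by (rule has_derivative_in_compose[rotated])
  moreover have "f' (h *\<^sub>R v) = f' v * h" for h
    using linear_scale[OF has_derivative_linear[OF f]] by simp
  ultimately have "(g has_real_derivative f' v) (at 0 within {0<..<d})"
    by (simp add: has_field_derivative_def)
  then obtain e where e: "e > 0" "\<And>h. h \<in> {0<..<d} \<Longrightarrow> h < e \<Longrightarrow> g 0 < g h"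
    using has_real_derivative_pos_inc_right[of g "f' v" 0 "{0<..<d}"] pos by force
  obtain \<delta> where \<delta>: "\<delta> > 0" "\<And>y. y \<in> S \<Longrightarrow> y \<noteq> z \<Longrightarrow> dist y z < \<delta> \<Longrightarrow> f y \<le> f z"
    using max unfolding eventually_at by blast
  define k where "k = min (min d e) (\<delta> / (norm v + 1))"
  define h where "h = k / 2"
  have "norm v + 1 > 0" by (simp add: add_nonneg_pos)
  then have "0 < k" using d e \<delta> by (simp add: k_def)
  moreover have "k \<le> d" "k \<le> e" "k \<le> \<delta> / (norm v + 1)" by (auto simp: k_def)
  ultimately have h: "0 < h" "h < d" "h < e" "h < \<delta> / (norm v + 1)"
    unfolding h_def by linarith+
  have "h * norm v \<le> h * (norm v + 1)" using h by simp
  also have "\<dots> < \<delta>" using h(4) \<open>norm v + 1 > 0\<close> by (simp add: field_simps)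
  finally have "dist (z + h *\<^sub>R v) z < \<delta>" using h(1) by (simp add: dist_norm)
  then have "f (z + h *\<^sub>R v) \<le> f z" using \<delta>(2) v h by (cases "z + h *\<^sub>R v = z") auto
  moreover have "g 0 < g h" using e(2)[of h] h by simp
  ultimately show False by (simp add: g_def)
qed

lemma planar_touched_above:
  assumes \<phi>: "test_function T \<phi> \<phi>t \<phi>x" and z: "(t, x) \<in> dom T"
    and touch: "touches_above T \<phi> (upper_env T (planar p l)) (t, x)"
  shows "\<phi>t (t, x) = - l" "p \<le> \<phi>x (t, x)" "x > 0 \<Longrightarrow> \<phi>x (t, x) = p"
proof -
  have env: "upper_env T (planar p l) y = ereal (planar p l y)" if "y \<in> dom T" for y
    using upper_env_continuous[OF continuous_planar] that dom_subset_dom0 by blast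
  define f' where "f' = (\<lambda>(s, y). (- l - \<phi>t (t, x)) * s + (p - \<phi>x (t, x)) * y)"
  have max: "\<forall>\<^sub>F y in at (t, x) within dom T. planar p l y - \<phi> y \<le> planar p l (t, x) - \<phi> (t, x)"
    using touch touches_above_cong[where w = "planar p l", OF env z] by blast
  have "((\<lambda>y. planar p l y - \<phi> y) has_derivative f') (at (t, x) within dom T)"
    using test_function_add[OF test_function_planar[of T p l] test_function_uminus[OF \<phi>]] z
    unfolding test_function_def f'_def by (auto simp: fun_eq_iff)
  note nonpos = local_max_derivative_nonpos[OF this max]
  have tx: "0 < t" "t < T" "0 \<le> x" using z by (auto simp: dom_def)
  have "f' (1, 0) \<le> 0"
    by (rule nonpos[of "T - t"]) (use tx in \<open>auto simp: dom_def\<close>)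
  moreover have "f' (- 1, 0) \<le> 0"
    by (rule nonpos[of t]) (use tx in \<open>auto simp: dom_def\<close>)
  moreover have "f' (0, 1) \<le> 0"
    by (rule nonpos[of 1]) (use tx in \<open>auto simp: dom_def\<close>)
  moreover have "f' (0, - 1) \<le> 0" if "x > 0"
    by (rule nonpos[of x]) (use tx that in \<open>auto simp: dom_def\<close>)
  ultimately show "\<phi>t (t, x) = - l" "p \<le> \<phi>x (t, x)" "x > 0 \<Longrightarrow> \<phi>x (t, x) = p"
    by (auto simp: f'_def)
qed

lemma planar_relaxed_subsolution:
  assumes "\<And>q. p \<le> q \<Longrightarrow> min (H q) (F q) \<le> H p"
  shows "relaxed_subsolution T H F (planar p (H p))"
  unfolding relaxed_subsolution_def
proof (intro allI impI)
  fix \<phi> \<phi>t \<phi>x :: "real \<times> real \<Rightarrow> real" and t x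
  assume A: "test_function T \<phi> \<phi>t \<phi>x \<and> (t, x) \<in> dom T \<and>
    touches_above T \<phi> (upper_env T (planar p (H p))) (t, x)"
  note \<phi> = planar_touched_above[of T \<phi> \<phi>t \<phi>x t x p "H p"]
  show "(x > 0 \<longrightarrow> \<phi>t (t, x) + H (\<phi>x (t, x)) \<le> 0) \<and>
      (x = 0 \<longrightarrow> \<phi>t (t, 0) + H (\<phi>x (t, 0)) \<le> 0 \<or> \<phi>t (t, 0) + F (\<phi>x (t, 0)) \<le> 0)"
    using \<phi> A assms[of "\<phi>x (t, x)"] by (auto simp: min_le_iff_disj)
qed

lemma planar_relaxed_solution:
  assumes "\<And>q. p \<le> q \<Longrightarrow> min (H q) (F q) \<le> H p" "\<And>q. q \<le> p \<Longrightarrow> H p \<le> max (H q) (F q)"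
  shows "relaxed_solution T H F (planar p (H p))"
  unfolding relaxed_solution_def
proof
  have "relaxed_subsolution T (reflect H) (reflect F) (planar (- p) (reflect H (- p)))"
    by (rule planar_relaxed_subsolution)
      (use assms(2)[of "- q" for q] in \<open>force simp: reflect_def min_le_iff_disj le_max_iff_disj\<close>)
  moreover have "planar (- p) (reflect H (- p)) = (\<lambda>z. - planar p (H p) z)"
    by (auto simp: planar_def reflect_def)
  ultimately show "relaxed_supersolution T H F (planar p (H p))"
    by (simp add: relaxed_supersolution_iff)
qed (use assms(1) in \<open>rule planar_relaxed_subsolution\<close>)

text \<open>Two planar functions with the same time derivative touch along \<open>x = 0\<close>, the one with the larger slope
  from above; so each can test the other.\<close>
lemma flux_limited_planar:
  assumes T: "T > 0" and sol: "flux_limited_solution T H G (planar p l)"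
  shows "p \<le> q \<Longrightarrow> G q \<le> l" "q \<le> p \<Longrightarrow> l \<le> G q"
proof -
  let ?z = "(T / 2, 0)"
  have z: "?z \<in> dom T" using T by (simp add: dom_def)
  have env: "upper_env T (planar p l) y = ereal (planar p l y)" if "y \<in> dom T" for p l y
    using upper_env_continuous[OF continuous_planar] that dom_subset_dom0 by blast
  have touch: "touches_above T (planar q l) (upper_env T (planar p l)) ?z" if "p \<le> q" for p q l
  proof (subst touches_above_cong[where w = "planar p l", OF env z])
    show "\<forall>\<^sub>F y in at ?z within dom T. planar p l y - planar q l y \<le> planar p l ?z - planar q l ?z"
      unfolding eventually_at_filter
      by (intro always_eventually) (use that in \<open>auto simp: planar_def dom_def intro: mult_right_mono\<close>)
  qed
  show "G q \<le> l" if "p \<le> q"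
    using sol test_function_planar[of T q l] z touch[OF that, of l]
    unfolding flux_limited_solution_def flux_limited_subsolution_def by fastforce
  show "l \<le> G q" if "q \<le> p"
  proof -
    have "(\<lambda>z. - planar p l z) = planar (- p) (- l)" "(\<lambda>z. - planar q l z) = planar (- q) (- l)"
      by (auto simp: planar_def)
    then have "touches_below T (planar q l) (lower_env T (planar p l)) ?z"
      using touch[of "- p" "- q" "- l"] that
      by (simp add: touches_below_iff_above flip: upper_env_uminus)
    then show ?thesis
      using sol test_function_planar[of T q l] z
      unfolding flux_limited_solution_def flux_limited_supersolution_def by fastforce
  qed
qed

section \<open>Relaxed solutions are flux-limited\<close>

context boundary_flux
begin

text \<open>Divergence of both \<open>H\<close> and \<open>F\<close> at minus infinity excludes the critical slope minus infinity.\<close>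
lemma relaxed_imp_flux_limited_subsolution:
  assumes Fbot: "filterlim F at_top at_bot"
    and u: "locally_bounded T u" "relaxed_subsolution T H F u"
  shows "flux_limited_subsolution T H G u"
  unfolding flux_limited_subsolution_def
proof (intro allI impI conjI)
  fix \<phi> \<phi>t \<phi>x :: "real \<times> real \<Rightarrow> real" and t x
  assume A: "test_function T \<phi> \<phi>t \<phi>x \<and> (t, x) \<in> dom T \<and> touches_above T \<phi> (upper_env T u) (t, x)"
  show "\<phi>t (t, x) + H (\<phi>x (t, x)) \<le> 0" if "x > 0"
    using u(2) A that unfolding relaxed_subsolution_def by blast
  show "\<phi>t (t, 0) + G (\<phi>x (t, 0)) \<le> 0" if "x = 0"
  proof -
    have \<phi>: "test_function T \<phi> \<phi>t \<phi>x" "(t, 0) \<in> dom T" "touches_above T \<phi> (upper_env T u) (t, 0)"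
      using A that by auto
    have "G (\<phi>x (t, 0)) \<le> - \<phi>t (t, 0)"
      using u contH \<phi>
    proof (cases rule: relaxed_subsolution_critical_slope)
      case 1
      have "\<forall>\<^sub>F q in at_bot. - \<phi>t (t, 0) < H q" "\<forall>\<^sub>F q in at_bot. - \<phi>t (t, 0) < F q"
        using Hbot Fbot by (auto simp: filterlim_at_top_dense)
      then have "\<forall>\<^sub>F q in at_bot. - \<phi>t (t, 0) < min (H q) (F q)"
        by eventually_elim simp
      then obtain q where "- \<phi>t (t, 0) < min (H q) (F q)"
        by (auto dest!: eventually_happens)
      then show ?thesis using 1[of q] by linarith
    next
      case (2 p0)
      then show ?thesis by (rule limited_flux_le)
    qed
    then show ?thesis by simp
  qed
qed

text \<open>The reflected critical slope can be plus infinity; coercivity of \<open>H\<close> then provides a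
  finite substitute.\<close>
lemma relaxed_imp_flux_limited_supersolution:
  assumes u: "locally_bounded T u" "relaxed_supersolution T H F u"
  shows "flux_limited_supersolution T H G u"
  unfolding flux_limited_supersolution_def
proof (intro allI impI conjI)
  fix \<phi> \<phi>t \<phi>x :: "real \<times> real \<Rightarrow> real" and t x
  assume A: "test_function T \<phi> \<phi>t \<phi>x \<and> (t, x) \<in> dom T \<and> touches_below T \<phi> (lower_env T u) (t, x)"
  show "\<phi>t (t, x) + H (\<phi>x (t, x)) \<ge> 0" if "x > 0"
    using u(2) A that unfolding relaxed_supersolution_def by blast
  show "\<phi>t (t, 0) + G (\<phi>x (t, 0)) \<ge> 0" if "x = 0"
  proof -
    have sub: "locally_bounded T (\<lambda>z. - u z)" "relaxed_subsolution T (reflect H) (reflect F) (\<lambda>z. - u z)"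
      using u by (simp_all add: locally_bounded_uminus relaxed_supersolution_iff)
    have contR: "continuous_on UNIV (reflect H)"
      unfolding reflect_def by (intro continuous_intros continuous_on_compose2[OF contH]) auto
    have \<phi>: "test_function T (\<lambda>z. - \<phi> z) (\<lambda>z. - \<phi>t z) (\<lambda>z. - \<phi>x z)" "(t, 0) \<in> dom T"
      "touches_above T (\<lambda>z. - \<phi> z) (upper_env T (\<lambda>z. - u z)) (t, 0)"
      using A that test_function_uminus by (auto simp: touches_below_iff_above upper_env_uminus)
    have unreflect: "- \<phi>t (t, 0) \<le> max (H q) (F q)"
      if "min (reflect H (- q)) (reflect F (- q)) \<le> - (- \<phi>t (t, 0))" for q
      using that by (auto simp: reflect_def)
    have "- \<phi>t (t, 0) \<le> G (\<phi>x (t, 0))"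
      using sub contR \<phi>
    proof (cases rule: relaxed_subsolution_critical_slope)
      case 1
      \<comment> \<open>Contact is never lost, so any larger slope can serve as the critical one.\<close>
      have "\<forall>\<^sub>F q in at_top. - \<phi>t (t, 0) < H q" using Htop by (auto simp: filterlim_at_top_dense)
      then have "\<forall>\<^sub>F q in at_top. - \<phi>t (t, 0) < H q \<and> \<phi>x (t, 0) \<le> q"
        using eventually_ge_at_top by (rule eventually_conj)
      then obtain p0 where "- \<phi>t (t, 0) < H p0" "\<phi>x (t, 0) \<le> p0"
        by (auto dest!: eventually_happens)
      then show ?thesis
        using 1 unreflect by (intro limited_flux_ge[of _ p0]) auto
    next
      case (2 p0)
      show ?thesis
      proof (rule limited_flux_ge[of _ "- p0"])
        show "- \<phi>t (t, 0) \<le> max (H q) (F q)" if "q \<le> - p0" for q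
          using 2(3)[of "- q"] that by (intro unreflect) simp
      qed (use 2(1,2) in \<open>auto simp: reflect_def\<close>)
    qed
    then show ?thesis by simp
  qed
qed

lemma relaxed_imp_flux_limited:
  assumes "filterlim F at_top at_bot" "locally_bounded T u" "relaxed_solution T H F u"
  shows "flux_limited_solution T H G u"
  using assms relaxed_imp_flux_limited_subsolution relaxed_imp_flux_limited_supersolution
  by (simp add: relaxed_solution_def flux_limited_solution_def)

lemma set_limiter_unique:
  assumes "T > 0" "set_limiter H A"
    and sol: "\<And>u. locally_bounded T u \<Longrightarrow> relaxed_solution T H F u \<Longrightarrow>
      flux_limited_solution T H (limited_flux H A) u"
  shows "A = A_F H F"
proof -
  have planar: "flux_limited_solution T H (limited_flux H A) (planar p (H p))" if "p \<in> A_F H F" for p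
    using A_F_imp_relaxed_slope[OF that]
    by (intro sol locally_bounded_continuous continuous_planar planar_relaxed_solution)
      (auto simp: relaxed_slope_def)
  show ?thesis
    using assms(2) by (rule set_limiter_eqI) (use flux_limited_planar[OF assms(1) planar] in auto)
qed

end

theorem theorem1p1:
  fixes T :: real and H F :: "real \<Rightarrow> real"
  assumes "T > 0"
    and "continuous_on UNIV H" and "filterlim H at_top at_infinity"
    and "continuous_on UNIV F" and "antimono F" and "filterlim F at_top at_bot"
  shows "(\<exists>!A. set_limiter H A \<and>
            (\<forall>u. locally_bounded T u \<and> relaxed_solution T H F u \<longrightarrow>
                 flux_limited_solution T H (limited_flux H A) u)) \<and>
         set_limiter H (A_F H F) \<and>
         (\<forall>u. locally_bounded T u \<and> relaxed_solution T H F u \<longrightarrow>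
              flux_limited_solution T H (limited_flux H (A_F H F)) u)"
proof -
  interpret boundary_flux H F
    using assms filterlim_mono[OF assms(3) order_refl at_bot_le_at_infinity]
      filterlim_mono[OF assms(3) order_refl at_top_le_at_infinity]
    by unfold_locales
  have flux: "\<forall>u. locally_bounded T u \<and> relaxed_solution T H F u \<longrightarrow> flux_limited_solution T H G u"
    using relaxed_imp_flux_limited[OF assms(6)] by blast
  show ?thesis
    using set_limiter_A_F flux set_limiter_unique[OF assms(1)] by blast
qed

end
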